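(* Let $t\neq0$ in $\mathbb{R}$, and let $f\in\mathcal{F}_{t,U}$ be an $\mathbb{R}$-differentiable function, where $U\in\mathcal{T}_t$ is connected and contains $0=0+0i+0j_t+0k_t\in\mathbb{H}_t$. If $f$ is $\mathbb{R}$-analytic on $U$, then $f$ is left $t$-regular on $U$ if and only if $$f=f(0)+\sum_{\mathbf{n}\in\mathbb{N}^3}\eta^{\mathbf{n}}f_{\mathbf{n}},\qquad\text{with}\qquad f_{\mathbf{n}}=\frac{1}{\mathbf{n}!}\,\frac{\partial^{n_1+n_2+n_3}f}{\partial x_2^{n_1}\partial x_3^{n_2}\partial x_4^{n_3}}(0),\quad\forall\,\mathbf{n}=(n_1,n_2,n_3)\in\mathbb{N}^3.$$
   Context: For $t\in\mathbb{R}$, $\mathbb{H}_t$ (the $t$-scaled hypercomplexes) is the associative unital real algebra with $\mathbb{R}$-basis $\{1,i,j_t,k_t\}$ and multiplication determined by $i^2=-1$, $j_t^2=k_t^2=t$, $ij_t=k_t$, $j_tk_t=-ti$, $k_ti=j_t$, $j_ti=-k_t$, $ik_t=-j_t$, $k_tj_t=ti$. Its elements are written $w=x_1+x_2i+x_3j_t+x_4k_t$ with $x_1,x_2,x_3,x_4\in\mathbb{R}$. $\mathcal{T}_t$ is the topology on $\mathbb{H}_t$ induced by the semi-norm $\|w\|_t=\sqrt{|x_1^2+x_2^2-t(x_3^2+x_4^2)|}$. $\mathcal{F}_{t,U}$ is the set of functions $f:\mathbb{H}_t\to\mathbb{H}_t$ that are $\mathbb{R}$-differentiable on $U$ ($U$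 being regarded as an open subset of $\mathbb{R}^4$); $\mathbb{R}$-analytic means real analytic in $(x_1,x_2,x_3,x_4)$. For $t\neq0$, $\mathrm{sgn}(t)=1$ if $t>0$ and $-1$ if $t<0$. A function $f\in\mathcal{F}_{t,U}$ is left $t$-regular on $U$ if $$\nabla_t f=\frac{\partial f}{\partial x_1}+i\frac{\partial f}{\partial x_2}-j_t\frac{\mathrm{sgn}(t)\,\partial f}{\sqrt{|t|}\,\partial x_3}-k_t\frac{\mathrm{sgn}(t)\,\partial f}{\sqrt{|t|}\,\partial x_4}=0$$ on $U$. The symmetrized product of functions $f_1,\dots,f_N:\mathbb{H}_t\to\mathbb{H}_t$ is $f_1\times\cdots\times f_N=\frac{1}{N!}\sum_{\sigma\in S_N}f_{\sigma(1)}f_{\sigma(2)}\cdots f_{\sigma(N)}$ (pointwise products in $\mathbb{H}_t$, $S_N$ the symmetric group on $\{1,\dots,N\}$), $f^{(n)}=f\times\cdots\times f$ ($n$ times) $=f^n$, and $f^{(0)}=1$. Put $$\eta_2(w)=x_2-x_1i,\quad \eta_3(w)=x_3+\frac{\mathrm{sgn}(t)x_1}{\sqrt{|t|}}j_t,\quad \eta_4(w)=x_4+\frac{\mathrm{sgn}(t)x_1}{\sqrt{|t|}}k_t .$$ With $\mathbb{N}_0=\mathbb{N}\cup\{0\}$, for $\mathbf{n}=(n_1,n_2,n_3)\in\mathbb{N}_0^3$ put $\mathbf{n}!=(n_1!)(n_2!)(n_3!)$ and $$\eta^{\mathbf{n}}=\frac{1}{\mathbf{n}!}\left(\eta_2^{(n_1)}\times\eta_3^{(n_2)}\times\eta_4^{(n_3)}\right),$$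 the product in parentheses being the symmetrized product of $n_1$ copies of $\eta_2$, $n_2$ copies of $\eta_3$ and $n_3$ copies of $\eta_4$.
   Formalization: Proved with a single factor 1/n! (in η^n; f_n is the plain partial derivative at 0), with n over N_0^3 without (0,0,0), and with the expansion holding, unconditionally summable, on some neighbourhood of 0 in U rather than on all of U; the literal formula fails for η_2^2 and 1/(1-x_1-x_2 i). *)

theory Defs
  imports "HOL-Analysis.Analysis"
begin

text \<open>
  The algebra \<open>\<H>\<^sub>t\<close> is carried by \<open>real ^ 4\<close>: the vector \<open>w\<close> stands for
  \<open>w$1 + w$2 i + w$3 j\<^sub>t + w$4 k\<^sub>t\<close>.  Only the additive and Euclidean structure of
  \<open>real ^ 4\<close> is used; its componentwise product and its \<open>1\<close> (the all-ones vector) are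
  not those of \<open>\<H>\<^sub>t\<close>, whose unit is \<open>h1\<close> and whose product is \<open>hmult t\<close>.
\<close>

abbreviation h1 :: "real ^ 4" where "h1 \<equiv> axis 1 1"
abbreviation hi :: "real ^ 4" where "hi \<equiv> axis 2 1"
abbreviation hj :: "real ^ 4" where "hj \<equiv> axis 3 1"
abbreviation hk :: "real ^ 4" where "hk \<equiv> axis 4 1"

definition hmult :: "real \<Rightarrow> real ^ 4 \<Rightarrow> real ^ 4 \<Rightarrow> real ^ 4" where
  "hmult t x y =
     (x$1 * y$1 - x$2 * y$2 + t * (x$3 * y$3) + t * (x$4 * y$4)) *\<^sub>R h1
   + (x$1 * y$2 + x$2 * y$1 - t * (x$3 * y$4) + t * (x$4 * y$3)) *\<^sub>R hi
   + (x$1 * y$3 + x$3 * y$1 - x$2 * y$4 + x$4 * y$2) *\<^sub>R hj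
   + (x$1 * y$4 + x$4 * y$1 + x$2 * y$3 - x$3 * y$2) *\<^sub>R hk"

lemma four_neq:
  "(1::4) \<noteq> 2" "(1::4) \<noteq> 3" "(1::4) \<noteq> 4" "(2::4) \<noteq> 3" "(2::4) \<noteq> 4" "(3::4) \<noteq> 4"
  by simp_all

lemma hmult_nth:
  "hmult t x y $ 1 = x$1 * y$1 - x$2 * y$2 + t * (x$3 * y$3) + t * (x$4 * y$4)"
  "hmult t x y $ 2 = x$1 * y$2 + x$2 * y$1 - t * (x$3 * y$4) + t * (x$4 * y$3)"
  "hmult t x y $ 3 = x$1 * y$3 + x$3 * y$1 - x$2 * y$4 + x$4 * y$2"
  "hmult t x y $ 4 = x$1 * y$4 + x$4 * y$1 + x$2 * y$3 - x$3 * y$2"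
  using four_neq four_neq[symmetric] by (simp_all add: hmult_def axis_def)

lemma hmult_table:
  "hmult t hi hi = - h1" "hmult t hj hj = t *\<^sub>R h1" "hmult t hk hk = t *\<^sub>R h1"
  "hmult t hi hj = hk" "hmult t hj hk = - t *\<^sub>R hi" "hmult t hk hi = hj"
  "hmult t hj hi = - hk" "hmult t hi hk = - hj" "hmult t hk hj = t *\<^sub>R hi"
  using four_neq four_neq[symmetric]
  by (simp_all add: vec_eq_iff forall_4 hmult_nth, simp_all add: axis_def)

lemma hmult_unit_assoc:
  "hmult t h1 x = x" "hmult t x h1 = x"
  "hmult t (hmult t x y) z = hmult t x (hmult t y z)"
  using four_neq four_neq[symmetric]
  by (simp_all add: vec_eq_iff forall_4 hmult_nth, simp_all add: axis_def algebra_simps)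

lemma bilinear_hmult: "bilinear (hmult t)"
  by (auto simp: bilinear_def vec_eq_iff forall_4 hmult_nth algebra_simps intro!: linearI)

definition hnorm :: "real \<Rightarrow> real ^ 4 \<Rightarrow> real" where
  "hnorm t w = sqrt \<bar>(w$1)\<^sup>2 + (w$2)\<^sup>2 - t * ((w$3)\<^sup>2 + (w$4)\<^sup>2)\<bar>"

text \<open>
  For \<open>t > 0\<close> the function \<open>hnorm t\<close> violates the triangle inequality, so its balls need not
  form a base; the induced topology is the one they generate as a subbase.
\<close>

definition htop :: "real \<Rightarrow> (real ^ 4) topology" where
  "htop t = topology_generated_by {{w. hnorm t (w - a) < r} |a r. 0 < r}"

definition partial :: "4 \<Rightarrow> (real ^ 4 \<Rightarrow> real ^ 4) \<Rightarrow> real ^ 4 \<Rightarrow> real ^ 4" where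
  "partial k f w = vector_derivative (\<lambda>s. f (w + s *\<^sub>R axis k 1)) (at 0)"

definition partial_multi :: "nat \<times> nat \<times> nat \<Rightarrow> (real ^ 4 \<Rightarrow> real ^ 4) \<Rightarrow> real ^ 4 \<Rightarrow> real ^ 4" where
  "partial_multi = (\<lambda>(n1, n2, n3) f. (partial 2 ^^ n1) ((partial 3 ^^ n2) ((partial 4 ^^ n3) f)))"

definition nabla :: "real \<Rightarrow> (real ^ 4 \<Rightarrow> real ^ 4) \<Rightarrow> real ^ 4 \<Rightarrow> real ^ 4" where
  "nabla t f w =
     partial 1 f w + hmult t hi (partial 2 f w)
     - hmult t hj ((sgn t / sqrt \<bar>t\<bar>) *\<^sub>R partial 3 f w)
     - hmult t hk ((sgn t / sqrt \<bar>t\<bar>) *\<^sub>R partial 4 f w)"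

definition left_regular_on :: "real \<Rightarrow> (real ^ 4 \<Rightarrow> real ^ 4) \<Rightarrow> (real ^ 4) set \<Rightarrow> bool" where
  "left_regular_on t f U \<longleftrightarrow> f differentiable_on U \<and> (\<forall>w\<in>U. nabla t f w = 0)"

definition real_analytic_on :: "(real ^ 'n \<Rightarrow> 'b::real_normed_vector) \<Rightarrow> (real ^ 'n) set \<Rightarrow> bool" where
  "real_analytic_on f U \<longleftrightarrow>
     (\<forall>a\<in>U. \<exists>(c :: ('n \<Rightarrow> nat) \<Rightarrow> 'b) r. 0 < r \<and>
        (\<forall>w\<in>ball a r.
           ((\<lambda>\<alpha>. (\<Prod>k\<in>UNIV. (w$k - a$k) ^ \<alpha> k) *\<^sub>R c \<alpha>) has_sum f w) UNIV))"

definition sym_prod :: "real \<Rightarrow> (real ^ 4 \<Rightarrow> real ^ 4) list \<Rightarrow> real ^ 4 \<Rightarrow> real ^ 4" where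
  "sym_prod t fs w =
     (1 / fact (length fs)) *\<^sub>R
     (\<Sum>\<sigma> | \<sigma> permutes {..<length fs}.
        foldr (hmult t) (map (\<lambda>m. (fs ! \<sigma> m) w) [0..<length fs]) h1)"

definition eta2 :: "real ^ 4 \<Rightarrow> real ^ 4" where
  "eta2 w = w$2 *\<^sub>R h1 - w$1 *\<^sub>R hi"

definition eta3 :: "real \<Rightarrow> real ^ 4 \<Rightarrow> real ^ 4" where
  "eta3 t w = w$3 *\<^sub>R h1 + (sgn t * w$1 / sqrt \<bar>t\<bar>) *\<^sub>R hj"

definition eta4 :: "real \<Rightarrow> real ^ 4 \<Rightarrow> real ^ 4" where
  "eta4 t w = w$4 *\<^sub>R h1 + (sgn t * w$1 / sqrt \<bar>t\<bar>) *\<^sub>R hk"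

text \<open>
  On the hyperplane \<open>w$1 = 0\<close> the symmetrized product below is the ordinary monomial, so
  \<open>eta_pow\<close> restricts to the monomial divided by \<open>n1! n2! n3!\<close>.  The factor \<open>1 / n!\<close> of Taylor's
  formula is thus already part of \<open>eta_pow\<close>, and the coefficients of an expansion in the
  \<open>eta_pow\<close> are the partial derivatives at \<open>0\<close> themselves.
\<close>

definition eta_pow :: "real \<Rightarrow> nat \<times> nat \<times> nat \<Rightarrow> real ^ 4 \<Rightarrow> real ^ 4" where
  "eta_pow t = (\<lambda>(n1, n2, n3) w.
     (1 / (fact n1 * fact n2 * fact n3)) *\<^sub>R
     sym_prod t (replicate n1 eta2 @ replicate n2 (eta3 t) @ replicate n3 (eta4 t)) w)"

end

(*
  Put e_2 = i, e_3 = - sgn t j_t / sqrt |t|, e_4 = - sgn t k_t / sqrt |t|, so that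
  nabla_t = d_1 + sum_k e_k d_k and eta_k = x_k - x_1 e_k.  Let P_n = eta^n; splitting off the
  first factor of the symmetrized product gives |n| P_n = sum_k eta_k P_(n - e_k).  Since the
  commutator of eta_k(w) and eta_l(h) is antisymmetric in k, l, induction gives
  dP_n(w)[h] = sum_k eta_k(h) P_(n - e_k)(w), hence nabla_t P_n = 0.  If f is the sum of the
  series near 0, differentiating term by term gives nabla_t f = 0 near 0, and the identity
  theorem for the analytic function nabla_t f extends this to U.
  Conversely, nabla_t f = 0 means D_1 c + sum_k e_k D_k c = 0 for the Taylor coefficients c of f
  at 0, where D_k is differentiation on coefficients.  Euler's identity for the homogeneous part
  T_N(c) then reads N T_N(c) = sum_k eta_k T_(N-1)(D_k c), so induction on N gives
  T_N(c) = sum over |n| = N of P_n f_n.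
*)
theory Submission
  imports Defs "HOL-Combinatorics.Multiset_Permutations"
begin

section \<open>The topology of the semi-norm\<close>

text \<open>Regrouping the Taylor series of \<open>f\<close> by degree does not by itself produce an
  unordered sum over triples n, so the series of the polynomials \<open>eta_pow\<close> needs a
  convergence proof of its own. It comes from balancing factorials: |P_n(w)| is at most (Q |w|)^|n|
  / n!, while n! times a Taylor coefficient is at most n! A / rho^|n|. This works for every analytic
  \<open>f\<close>, regular or not, and yields a regular function g near 0. Both directions compare
  \<open>f\<close> with this one g: equality of homogeneous parts gives f = g when \<open>f\<close>
  is regular, and the expansion itself says f = g in the converse. For t > 0 the algebra has zero
  divisors and the semi-norm belongs to an indefinite form, so the estimates use the Euclidean norm
  throughout. This is legitimate because the balls of the semi-norm generate the Euclidean
  topology.\<close>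

lemma openin_htop_ball: "0 < r \<Longrightarrow> openin (htop t) {w. hnorm t (w - a) < r}"
  unfolding htop_def by (rule topology_generated_by_Basis) auto

lemma hnorm_less_iff: "0 < r \<Longrightarrow> hnorm t w < r \<longleftrightarrow> \<bar>(w$1)\<^sup>2 + (w$2)\<^sup>2 - t * ((w$3)\<^sup>2 + (w$4)\<^sup>2)\<bar> < r\<^sup>2"
proof -
  assume "0 < r"
  then have "r = sqrt (r\<^sup>2)" by simp
  then show ?thesis unfolding hnorm_def by (metis real_sqrt_less_iff)
qed

lemma continuous_on_hnorm: "continuous_on UNIV (\<lambda>w. hnorm t (w - a))"
  unfolding hnorm_def by (intro continuous_intros)

lemma norm_le_sum_components_4:
  fixes w :: "real ^ 4"
  assumes "\<And>k. \<bar>w$k\<bar> \<le> b"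
  shows "norm w \<le> 4 * b"
proof -
  have "norm w \<le> (\<Sum>k\<in>UNIV. \<bar>w$k\<bar>)" by (rule norm_le_l1_cart)
  also have "\<dots> \<le> of_nat (card (UNIV::4 set)) * b" by (rule sum_bounded_above) (use assms in auto)
  finally show ?thesis by simp
qed

text \<open>For t < 0 the semi-norm is a weighted Euclidean norm and one ball suffices. For t > 0
  the balls are unbounded along the null cone, so finitely many translates are intersected;
  \<open>p\<close> lies in each of them because the centres differ from \<open>p\<close> by null
  vectors.\<close>

lemma htop_neighbourhood:
  assumes "t \<noteq> 0" "0 < e"
  obtains T where "openin (htop t) T" "p \<in> T" "T \<subseteq> ball p e"
proof -
  define m where "m = min 1 (sqrt \<bar>t\<bar>)"
  have m: "0 < m" "m \<le> 1" "m \<le> sqrt \<bar>t\<bar>" using assms by (auto simp: m_def)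
  \<comment> \<open>Coordinates of size at most e/5 give norm at most 4e/5 < e. The factor
    \<open>m\<close> absorbs the weight sqrt |t| of the last two coordinates when it is below
    1.\<close>
  define d where "d = e * m / 5"
  have d: "0 < d" using m assms by (simp add: d_def)
  have "e * m \<le> e" using m assms(2) by (intro mult_left_le) auto
  then have d5: "d \<le> e / 5" by (simp add: d_def)
  have small: "w \<in> ball p e" if "\<bar>(w - p)$1\<bar> \<le> d" "\<bar>(w - p)$2\<bar> \<le> d"
      "sqrt \<bar>t\<bar> * \<bar>(w - p)$3\<bar> \<le> d" "sqrt \<bar>t\<bar> * \<bar>(w - p)$4\<bar> \<le> d" for w
  proof -
    have a: "\<bar>x\<bar> \<le> e / 5" if "\<bar>x\<bar> \<le> d" for x
      using that d5 by linarith
    have b: "\<bar>x\<bar> \<le> e / 5" if "sqrt \<bar>t\<bar> * \<bar>x\<bar> \<le> d" for x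
    proof -
      have "m * \<bar>x\<bar> \<le> sqrt \<bar>t\<bar> * \<bar>x\<bar>" using m by (intro mult_right_mono) auto
      with that have "m * \<bar>x\<bar> \<le> m * (e / 5)" by (simp add: d_def mult.commute)
      then show ?thesis using m(1) by (simp add: mult_le_cancel_left_pos)
    qed
    have "\<bar>(w - p)$k\<bar> \<le> e / 5" for k
      using exhaust_4[of k] that a b by fastforce
    then have "norm (w - p) \<le> 4 * (e / 5)" by (rule norm_le_sum_components_4)
    then show ?thesis using assms(2) by (simp add: dist_norm norm_minus_commute)
  qed
  show thesis
  proof (cases "t < 0")
    case True
    let ?T = "{w. hnorm t (w - p) < d}"
    have "w \<in> ball p e" if "w \<in> ?T" for w
    proof (rule small)
      let ?u = "w - p"
      have *: "\<bar>(?u$1)\<^sup>2 + (?u$2)\<^sup>2 - t * ((?u$3)\<^sup>2 + (?u$4)\<^sup>2)\<bar> < d\<^sup>2"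
        using that d by (simp add: hnorm_less_iff)
      have t: "(sqrt \<bar>t\<bar>)\<^sup>2 = - t" using True by simp
      have pos: "0 \<le> - t * (?u$3)\<^sup>2" "0 \<le> - t * (?u$4)\<^sup>2" using True by (auto simp: mult_nonpos_nonneg)
      have exp: "(?u$1)\<^sup>2 + (?u$2)\<^sup>2 - t * ((?u$3)\<^sup>2 + (?u$4)\<^sup>2) = (?u$1)\<^sup>2 + (?u$2)\<^sup>2 + (- t * (?u$3)\<^sup>2) + (- t * (?u$4)\<^sup>2)"
        by (simp add: algebra_simps)
      have lt: "(?u$1)\<^sup>2 + (?u$2)\<^sup>2 + (- t * (?u$3)\<^sup>2) + (- t * (?u$4)\<^sup>2) < d\<^sup>2"
        using * unfolding exp by linarith
      have 1: "(?u$1)\<^sup>2 \<le> d\<^sup>2" and 2: "(?u$2)\<^sup>2 \<le> d\<^sup>2" 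
        and 3: "- t * (?u$3)\<^sup>2 \<le> d\<^sup>2" and 4: "- t * (?u$4)\<^sup>2 \<le> d\<^sup>2"
        using lt pos zero_le_power2[of "?u$1"] zero_le_power2[of "?u$2"] by linarith+
      show "\<bar>?u$1\<bar> \<le> d" "\<bar>?u$2\<bar> \<le> d"
        by (rule power2_le_imp_le; use 1 2 d in \<open>simp only: power2_abs less_imp_le\<close>)+
      show "sqrt \<bar>t\<bar> * \<bar>?u$3\<bar> \<le> d" "sqrt \<bar>t\<bar> * \<bar>?u$4\<bar> \<le> d"
        by (rule power2_le_imp_le; use 3 4 d in \<open>simp only: power_mult_distrib t power2_abs less_imp_le\<close>)+
    qed
    then have "?T \<subseteq> ball p e" by blast
    moreover have "p \<in> ?T" using d by (simp add: hnorm_def)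
    ultimately show ?thesis using that[OF openin_htop_ball[OF d]] by blast
  next
    case False
    define s where "s = sqrt t"
    have s: "0 < s" "t = s\<^sup>2" using False assms by (auto simp: s_def)
    \<comment> \<open>The quadratic terms will cancel and leave linear bounds, so the squared radius
      has to be \<open>d\<close> itself.\<close>
    define r where "r = sqrt d"
    have r: "0 < r" "r\<^sup>2 = d" using d by (auto simp: r_def)
    \<comment> \<open>For a null vector \<open>n\<close> the quadratic form at \<open>u - n\<close> is that at \<open>u\<close> plus a linear form in \<open>u\<close>;
      four null vectors suffice to bound all coordinates.\<close>
    define N :: "(real ^ 4) set" where "N = {0, h1 + (1/s) *\<^sub>R hj, h1 - (1/s) *\<^sub>R hj, hi + (1/s) *\<^sub>R hk, hi - (1/s) *\<^sub>R hk}"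
    let ?T = "\<Inter>n\<in>N. {w. hnorm t (w - (p + n)) < r}"
    have "openin (htop t) ?T"
      by (rule openin_INT2) (auto simp: N_def openin_htop_ball r)
    moreover have "p \<in> ?T"
      using s r d four_neq four_neq[symmetric] by (simp add: N_def hnorm_less_iff axis_def power_divide)
    moreover have "w \<in> ball p e" if "w \<in> ?T" for w
    proof -
      let ?u = "w - p"
      have Q: "\<bar>((?u - n)$1)\<^sup>2 + ((?u - n)$2)\<^sup>2 - t * (((?u - n)$3)\<^sup>2 + ((?u - n)$4)\<^sup>2)\<bar> < d" if "n \<in> N" for n
      proof -
        have "hnorm t (?u - n) < r" using \<open>w \<in> ?T\<close> that by (force simp: algebra_simps)
        then show ?thesis using r by (simp add: hnorm_less_iff)
      qed
      let ?q = "(?u$1)\<^sup>2 + (?u$2)\<^sup>2 - t * ((?u$3)\<^sup>2 + (?u$4)\<^sup>2)"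
      have 0: "\<bar>?q\<bar> < d" using Q[of 0] by (simp add: N_def)
      have null: "(x - 1)\<^sup>2 + y\<^sup>2 - t * ((z - 1 / s)\<^sup>2 + v\<^sup>2) = x\<^sup>2 + y\<^sup>2 - t * (z\<^sup>2 + v\<^sup>2) - 2 * (x - s * z)"
        "(x - 1)\<^sup>2 + y\<^sup>2 - t * ((z + 1 / s)\<^sup>2 + v\<^sup>2) = x\<^sup>2 + y\<^sup>2 - t * (z\<^sup>2 + v\<^sup>2) - 2 * (x + s * z)"
        "y\<^sup>2 + (x - 1)\<^sup>2 - t * (v\<^sup>2 + (z - 1 / s)\<^sup>2) = y\<^sup>2 + x\<^sup>2 - t * (v\<^sup>2 + z\<^sup>2) - 2 * (x - s * z)"
        "y\<^sup>2 + (x - 1)\<^sup>2 - t * (v\<^sup>2 + (z + 1 / s)\<^sup>2) = y\<^sup>2 + x\<^sup>2 - t * (v\<^sup>2 + z\<^sup>2) - 2 * (x + s * z)"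
        for x y z v :: real
        using s(1) by (simp_all add: s(2) power2_eq_square field_simps)
      have 1: "\<bar>?q - 2 * (?u$1 - s * ?u$3)\<bar> < d"
        using Q[of "h1 + (1/s) *\<^sub>R hj"] four_neq four_neq[symmetric]
        by (simp add: N_def axis_def null)
      have 2: "\<bar>?q - 2 * (?u$1 + s * ?u$3)\<bar> < d"
        using Q[of "h1 - (1/s) *\<^sub>R hj"] four_neq four_neq[symmetric]
        by (simp add: N_def axis_def null)
      have 3: "\<bar>?q - 2 * (?u$2 - s * ?u$4)\<bar> < d"
        using Q[of "hi + (1/s) *\<^sub>R hk"] four_neq four_neq[symmetric]
        by (simp add: N_def axis_def null)
      have 4: "\<bar>?q - 2 * (?u$2 + s * ?u$4)\<bar> < d"
        using Q[of "hi - (1/s) *\<^sub>R hk"] four_neq four_neq[symmetric]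
        by (simp add: N_def axis_def null)
      \<comment> \<open>Comparing the second and third value with the first bounds |x - y| and |x +
        y| by \<open>d\<close>, hence also |x| and |y|.\<close>
      have sep: "\<bar>x\<bar> \<le> d" "\<bar>y\<bar> \<le> d"
        if "\<bar>q\<bar> < d" "\<bar>q - 2 * (x - y)\<bar> < d" "\<bar>q - 2 * (x + y)\<bar> < d" for q x y :: real
        using that unfolding abs_less_iff abs_le_iff by auto
      note 13 = sep[OF 0 1 2] sep[OF 0 3 4]
      have ss: "sqrt \<bar>t\<bar> = s" using s by simp
      show ?thesis by (rule small) (use 13 s in \<open>auto simp: ss abs_mult simp del: vector_minus_component\<close>)
    qed
    ultimately show ?thesis using that[of ?T] by blast
  qed
qed

text \<open>Generating balls are open because \<open>hnorm t\<close> is continuous; the converse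
  rests on the neighbourhoods just built. At t = 0 the form does not see x_3 and x_4, and the
  equivalence would fail.\<close>

lemma openin_htop_iff:
  assumes "t \<noteq> 0"
  shows "openin (htop t) S \<longleftrightarrow> open S"
proof
  assume "openin (htop t) S"
  then have "generate_topology_on {{w. hnorm t (w - a) < r} |a r. 0 < r} S"
    by (simp add: htop_def openin_topology_generated_by)
  then show "open S"
  proof induction
    case (Basis s)
    then obtain a r where "s = {w. hnorm t (w - a) < r}" by blast
    then show ?case by (simp add: open_Collect_less continuous_on_hnorm)
  qed auto
next
  assume S: "open S"
  show "openin (htop t) S"
  proof (subst openin_subopen, safe)
    fix p assume "p \<in> S"
    then obtain e where "0 < e" "ball p e \<subseteq> S" using S open_contains_ball by blast
    obtain T where "openin (htop t) T" "p \<in> T" "T \<subseteq> ball p e"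
      using htop_neighbourhood[OF assms \<open>0 < e\<close>] by metis
    with \<open>ball p e \<subseteq> S\<close> show "\<exists>T. openin (htop t) T \<and> p \<in> T \<and> T \<subseteq> S"
      by blast
  qed
qed

lemma htop_eq_euclidean: "t \<noteq> 0 \<Longrightarrow> htop t = euclidean"
  by (simp add: topology_eq openin_htop_iff)

section \<open>Termwise differentiation of infinite sums\<close>

text \<open>In finite dimension unordered summability is absolute: each coordinate is a summable
  real family, and the norm is at most the sum of the absolute coordinates.\<close>

lemma summable_on_imp_norm_summable_on:
  fixes f :: "'i \<Rightarrow> 'b::euclidean_space"
  assumes "f summable_on A"
  shows "(\<lambda>i. norm (f i)) summable_on A"
proof (rule Infinite_Sum.abs_summable_on_comparison_test')
  have "(\<lambda>i. \<bar>f i \<bullet> b\<bar>) summable_on A" for b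
    using summable_on_bounded_linear[OF bounded_linear_inner_left assms, of b]
    by (simp add: summable_on_iff_abs_summable_on_real[of "\<lambda>i. f i \<bullet> b"])
  note abs = this
  have "(\<lambda>i. \<Sum>b\<in>B. \<bar>f i \<bullet> b\<bar>) summable_on A" if "finite B" for B
    using that by (induction B rule: finite_induct) (auto intro: summable_on_add abs)
  then show "(\<lambda>i. \<Sum>b\<in>Basis. \<bar>f i \<bullet> b\<bar>) summable_on A" by simp
  show "norm (f i) \<le> (\<Sum>b\<in>Basis. \<bar>f i \<bullet> b\<bar>)" for i by (rule norm_le_l1)
qed

lemma has_sum_diff:
  fixes f g :: "'i \<Rightarrow> 'b::real_normed_vector"
  assumes "(f has_sum a) A" "(g has_sum b) A"
  shows "((\<lambda>i. f i - g i) has_sum (a - b)) A"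
  using has_sum_add[OF assms(1) has_sum_scaleR[OF assms(2), of "-1"]] by simp

text \<open>The normalized remainders tend to 0 term by term, and the mean value inequality on the
  convex set \<open>S\<close> bounds them by \<open>2 * M i\<close>. The Weierstrass test then makes
  their sum uniform on \<open>S\<close>, so limit and sum may be exchanged.\<close>

lemma has_derivative_infsum:
  fixes F :: "'i \<Rightarrow> 'a::real_normed_vector \<Rightarrow> 'b::banach"
  assumes S: "convex S" "open S" "x \<in> S"
    and F: "\<And>i y. y \<in> S \<Longrightarrow> (F i has_derivative F' i y) (at y)"
    and M: "\<And>i. 0 \<le> M i" "M summable_on I"
    and F'_le: "\<And>i y h. y \<in> S \<Longrightarrow> norm (F' i y h) \<le> M i * norm h"
    and g: "\<And>y. y \<in> S \<Longrightarrow> ((\<lambda>i. F i y) has_sum g y) I"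
  shows "(g has_derivative (\<lambda>h. \<Sum>\<^sub>\<infinity>i\<in>I. F' i x h)) (at x)"
    and "((\<lambda>i. F' i x h) has_sum (\<Sum>\<^sub>\<infinity>i\<in>I. F' i x h)) I"
proof -
  have "(\<lambda>i. norm (F' i x h)) summable_on I" for h
    by (rule Infinite_Sum.abs_summable_on_comparison_test'[where g="\<lambda>i. M i * norm h"])
       (rule summable_on_cmult_left[OF M(2)], rule F'_le[OF S(3)])
  then have sm: "(\<lambda>i. F' i x h) summable_on I" for h
    by (rule abs_summable_summable)
  then show hs: "((\<lambda>i. F' i x h) has_sum (\<Sum>\<^sub>\<infinity>i\<in>I. F' i x h)) I" for h
    by (rule has_sum_infsum)
  let ?G = "\<lambda>h. \<Sum>\<^sub>\<infinity>i\<in>I. F' i x h"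
  have lin: "bounded_linear (F' i x)" for i using F[OF S(3)] by (rule has_derivative_bounded_linear)
  \<comment> \<open>At \<open>y = x\<close> the division by zero gives 0, which is consistent with
    the bound below.\<close>
  define R where "R i y = (F i y - F i x - F' i x (y - x)) /\<^sub>R norm (y - x)" for i y
  let ?g = "\<lambda>y. (g y - g x - ?G (y - x)) /\<^sub>R norm (y - x)"
  have R: "((\<lambda>i. R i y) has_sum ?g y) I" if "y \<in> S" for y
    unfolding R_def by (intro has_sum_scaleR has_sum_diff g hs that S)
  have bd: "norm (R i y) \<le> 2 * M i" if y: "y \<in> S" for i y
  proof (cases "y = x")
    case True
    then show ?thesis using M(1)[of i] by (simp add: R_def)
  next
    case False
    have "norm (F i y - F i x) \<le> M i * norm (y - x)"
      using F F'_le M(1) by (intro differentiable_bound[OF S(1) _ _ y S(3), of _ "F' i"])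
      (blast intro: has_derivative_at_withinI onorm_bound)+
    moreover have "norm (F' i x (y - x)) \<le> M i * norm (y - x)" using F'_le S by blast
    ultimately have "norm (F i y - F i x - F' i x (y - x)) \<le> 2 * M i * norm (y - x)"
      using norm_triangle_ineq4[of "F i y - F i x" "F' i x (y - x)"] by linarith
    then show ?thesis using False by (simp add: R_def divide_simps mult.commute)
  qed
  have at: "at x within S = at x" using S(3,2) by (rule at_within_open)
  have "uniform_limit S (\<lambda>X y. \<Sum>i\<in>X. R i y) ?g (finite_subsets_at_top I)"
    using bd R summable_on_cmult_right[OF M(2)] by (rule Weierstrass_m_test_general')
  note unif = this
  have "(R i \<longlongrightarrow> 0) (at x)" for i
    using F[OF S(3), of i] unfolding has_derivative_at_within R_def by blast
  then have "((\<lambda>y. \<Sum>i\<in>X. R i y) \<longlongrightarrow> (\<Sum>i\<in>X. 0)) (at x)" for X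
    by (intro tendsto_sum)
  then have "\<forall>\<^sub>F X in finite_subsets_at_top I. ((\<lambda>y. \<Sum>i\<in>X. R i y) \<longlongrightarrow> 0) (at x within S)"
    unfolding at by (simp only: sum.neutral_const eventually_True simp_thms)
  then have "(?g \<longlongrightarrow> 0) (at x within S)"
    by (rule swap_uniform_limit[OF _ tendsto_const unif finite_subsets_at_top_neq_bot])
  then have lim: "(?g \<longlongrightarrow> 0) (at x)" unfolding at .
  have "linear ?G"
  proof (rule linearI)
    fix a b :: 'a and c :: real
    have "((\<lambda>i. F' i x (a + b)) has_sum (?G a + ?G b)) I"
      unfolding linear_add[OF bounded_linear.linear[OF lin]] by (rule has_sum_add[OF hs hs])
    then show "?G (a + b) = ?G a + ?G b" by (rule infsumI)
    have "((\<lambda>i. F' i x (c *\<^sub>R a)) has_sum (c *\<^sub>R ?G a)) I"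
      unfolding linear_scale[OF bounded_linear.linear[OF lin]] by (rule has_sum_scaleR[OF hs])
    then show "?G (c *\<^sub>R a) = c *\<^sub>R ?G a" by (rule infsumI)
  qed
  moreover have "norm (?G h) \<le> norm h * (\<Sum>\<^sub>\<infinity>i\<in>I. M i)" for h
  proof -
    have "norm (?G h) \<le> (\<Sum>\<^sub>\<infinity>i\<in>I. M i * norm h)"
      by (rule norm_infsum_le[OF has_sum_infsum[OF sm] has_sum_infsum])
         (rule summable_on_cmult_left[OF M(2)], rule F'_le[OF S(3)])
    also have "\<dots> = norm h * (\<Sum>\<^sub>\<infinity>i\<in>I. M i)"
      using M(2) by (simp add: infsum_cmult_left mult.commute)
    finally show ?thesis .
  qed
  ultimately have "bounded_linear ?G" 
    unfolding bounded_linear_def bounded_linear_axioms_def by blast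
  then show "(g has_derivative ?G) (at x)"
    unfolding has_derivative_at_within using lim by blast
qed

section \<open>Power series in several variables\<close>

definition mpow :: "real ^ 'n \<Rightarrow> ('n::finite \<Rightarrow> nat) \<Rightarrow> real" where
  "mpow v \<alpha> = (\<Prod>k\<in>UNIV. v$k ^ \<alpha> k)"

lemma mpow_upd: "mpow v (\<alpha>(k := m)) = v$k ^ m * (\<Prod>j\<in>UNIV - {k}. v$j ^ \<alpha> j)"
  unfolding mpow_def by (subst prod.remove[of _ k]) (auto intro!: prod.cong)

lemma mpow_Suc: "mpow v (\<alpha>(k := Suc (\<alpha> k))) = v$k * mpow v \<alpha>"
  using mpow_upd[of v \<alpha> k "\<alpha> k"] by (simp add: mpow_upd)

lemma mpow_zero_vec: "mpow 0 \<alpha> = (if \<alpha> = (\<lambda>_. 0) then 1 else 0)"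
  by (auto simp: mpow_def fun_eq_iff)

lemma has_derivative_mpow:
  "((\<lambda>w. mpow (w - a) \<alpha>) has_derivative
     (\<lambda>h. \<Sum>k\<in>UNIV. h$k * (real (\<alpha> k) * mpow (w - a) (\<alpha>(k := \<alpha> k - 1))))) (at w)"
proof -
  have "((\<lambda>w. (w - a)$k) has_derivative (\<lambda>h. h$k)) (at w)" for k
    by (auto intro!: derivative_eq_intros bounded_linear_imp_has_derivative bounded_linear_vec_nth)
  from has_derivative_prod[OF has_derivative_power[OF this]]
  show ?thesis
    unfolding mpow_upd unfolding mpow_def
    by (rule has_derivative_eq_rhs) (simp add: fun_eq_iff algebra_simps)
qed

text \<open>The left side is the term linear in \<open>d\<close> of the binomial expansion of the
  right side, all of whose terms are nonnegative. It trades a derivative for an enlargement of the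
  argument by \<open>d\<close>.\<close>

lemma power_diff_bound:
  fixes y d :: real
  assumes "0 \<le> y" "0 \<le> d"
  shows "real m * y ^ (m - 1) * d \<le> (y + d) ^ m"
proof (induction m)
  case (Suc m)
  have "real (Suc m) * y ^ m * d = y * (real m * y ^ (m - 1) * d) + d * y ^ m"
    by (cases m) (auto simp: algebra_simps)
  also have "\<dots> \<le> y * (y + d) ^ m + d * (y + d) ^ m"
    using assms Suc by (intro add_mono mult_left_mono power_mono) auto
  finally show ?case by (simp add: algebra_simps)
qed simp

lemma mpow_derivative_bound:
  fixes v y :: "real ^ 'n"
  assumes "\<And>k. \<bar>v$k\<bar> \<le> y$k" "0 < d"
  shows "real (\<alpha> k) * \<bar>mpow v (\<alpha>(k := \<alpha> k - 1))\<bar> \<le> mpow (\<chi> k. y$k + d) \<alpha> / d"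
proof -
  have y: "0 \<le> y$j" for j using assms(1)[of j] by linarith
  have "real (\<alpha> k) * \<bar>mpow v (\<alpha>(k := \<alpha> k - 1))\<bar> * d
      = (real (\<alpha> k) * \<bar>v$k\<bar> ^ (\<alpha> k - 1) * d) * (\<Prod>j\<in>UNIV - {k}. \<bar>v$j\<bar> ^ \<alpha> j)"
    by (simp add: mpow_upd abs_mult abs_prod power_abs)
  also have "\<dots> \<le> (y$k + d) ^ \<alpha> k * (\<Prod>j\<in>UNIV - {k}. (y$j + d) ^ \<alpha> j)"
  proof (rule mult_mono)
    have "real (\<alpha> k) * \<bar>v$k\<bar> ^ (\<alpha> k - 1) * d \<le> (\<bar>v$k\<bar> + d) ^ \<alpha> k"
      using assms(2) by (intro power_diff_bound) auto
    also have "\<dots> \<le> (y$k + d) ^ \<alpha> k" using assms by (intro power_mono) auto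
    finally show "real (\<alpha> k) * \<bar>v$k\<bar> ^ (\<alpha> k - 1) * d \<le> (y$k + d) ^ \<alpha> k" .
    show "(\<Prod>j\<in>UNIV - {k}. \<bar>v$j\<bar> ^ \<alpha> j) \<le> (\<Prod>j\<in>UNIV - {k}. (y$j + d) ^ \<alpha> j)"
      using assms by (intro prod_mono conjI power_mono) (auto intro: add_increasing2)
    show "0 \<le> (y$k + d) ^ \<alpha> k" using y[of k] assms by simp
  qed (auto intro: prod_nonneg)
  also have "\<dots> = mpow (\<chi> k. y$k + d) \<alpha>"
    using mpow_upd[of "\<chi> k. y$k + d" \<alpha> k "\<alpha> k"] by simp
  finally show ?thesis using assms(2) by (simp add: pos_le_divide_eq)
qed

definition powser :: "(('n::finite \<Rightarrow> nat) \<Rightarrow> 'b::real_normed_vector) \<Rightarrow> real \<Rightarrow> real ^ 'n \<Rightarrow> (real ^ 'n \<Rightarrow> 'b) \<Rightarrow> bool" where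
  "powser c r a f \<longleftrightarrow> (\<forall>w\<in>ball a r. ((\<lambda>\<alpha>. mpow (w - a) \<alpha> *\<^sub>R c \<alpha>) has_sum f w) UNIV)"

definition dcoef :: "'n \<Rightarrow> (('n \<Rightarrow> nat) \<Rightarrow> 'b::real_vector) \<Rightarrow> ('n \<Rightarrow> nat) \<Rightarrow> 'b" where
  "dcoef k c \<alpha> = real (Suc (\<alpha> k)) *\<^sub>R c (\<alpha>(k := Suc (\<alpha> k)))"

text \<open>Raising entry \<open>k\<close> is a bijection onto the indices with positive entry
  \<open>k\<close>. This removes the truncated subtraction in the derivative of a monomial, where
  the factor \<open>real (\<alpha> k)\<close> kills the terms with
  \<open>\<alpha> k = 0\<close>.\<close>

lemma has_sum_shift_index:
  fixes F :: "('n \<Rightarrow> nat) \<Rightarrow> 'b::{comm_monoid_add,topological_space}"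
  assumes "\<And>\<alpha>. \<alpha> k = 0 \<Longrightarrow> F \<alpha> = 0"
  shows "((\<lambda>\<beta>. F (\<beta>(k := Suc (\<beta> k)))) has_sum L) UNIV \<longleftrightarrow> (F has_sum L) UNIV"
proof -
  have "((\<lambda>\<beta>. F (\<beta>(k := Suc (\<beta> k)))) has_sum L) UNIV \<longleftrightarrow> (F has_sum L) {\<alpha>. 0 < \<alpha> k}"
    by (rule has_sum_reindex_bij_witness[where i="\<lambda>\<alpha>. \<alpha>(k := \<alpha> k - 1)" and j="\<lambda>\<beta>. \<beta>(k := Suc (\<beta> k))"])
       (auto simp: fun_eq_iff)
  also have "\<dots> \<longleftrightarrow> (F has_sum L) UNIV"
    by (rule has_sum_cong_neutral) (use assms in auto)
  finally show ?thesis .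
qed

text \<open>The summable majorant is the series of norms at a single point: the monomials at
  \<open>z\<close>, whose coordinates are nonnegative and exceed those of |w - a|, dominate the
  derivatives of all monomials on a neighbourhood of \<open>w\<close>.\<close>

lemma powser_has_derivative:
  fixes c :: "('n::finite \<Rightarrow> nat) \<Rightarrow> 'b::euclidean_space"
  assumes ps: "powser c r a f" and w: "w \<in> ball a r"
  obtains G where "(f has_derivative G) (at w)"
    "\<And>k. ((\<lambda>\<beta>. mpow (w - a) \<beta> *\<^sub>R dcoef k c \<beta>) has_sum G (axis k 1)) UNIV"
proof -
  define y :: "real ^ 'n" where "y = (\<chi> k. \<bar>(w - a)$k\<bar>)"
  have ny: "norm y = norm (w - a)" by (simp add: y_def norm_vec_def)
  define N where "N = real CARD('n)"
  have N: "0 < N" by (simp add: N_def)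
  \<comment> \<open>Each coordinate is enlarged by \<open>2 * d\<close>: one \<open>d\<close> for
    moving from \<open>w\<close> to a nearby \<open>v\<close>, one for
    \<open>mpow_derivative_bound\<close>. The total enlargement \<open>N * (2 * d)\<close> is half
    of the distance left to the boundary.\<close>
  define d where "d = (r - norm (w - a)) / (4 * N)"
  have d: "0 < d" using w N by (simp add: d_def dist_norm norm_minus_commute)
  define z :: "real ^ 'n" where "z = (\<chi> k. y$k + 2 * d)"
  have "norm (z - y) \<le> (\<Sum>k\<in>UNIV. \<bar>(z - y)$k\<bar>)" by (rule norm_le_l1_cart)
  also have "\<dots> = N * (2 * d)" using d by (simp add: z_def N_def)
  finally have "norm (z - y) \<le> N * (2 * d)" .
  moreover have "N * (2 * d) < r - norm (w - a)"
    using w N by (simp add: d_def dist_norm norm_minus_commute)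
  ultimately have nz: "norm z < r" using norm_triangle_ineq2[of z y] ny by linarith
  have "((\<lambda>\<alpha>. mpow z \<alpha> *\<^sub>R c \<alpha>) has_sum f (a + z)) UNIV"
    using ps nz by (auto simp: powser_def dist_norm dest: bspec[of _ _ "a + z"])
  then have "(\<lambda>\<alpha>. norm (mpow z \<alpha> *\<^sub>R c \<alpha>)) summable_on UNIV"
    by (rule summable_on_imp_norm_summable_on[OF has_sum_imp_summable])
  moreover have z: "0 \<le> z$k" for k using d by (simp add: z_def y_def)
  then have mz: "0 \<le> mpow z \<alpha>" for \<alpha> by (auto simp: mpow_def intro!: prod_nonneg)
  ultimately have sm: "(\<lambda>\<alpha>. mpow z \<alpha> * norm (c \<alpha>)) summable_on UNIV" by simp
  define F' where "F' \<alpha> v h = (\<Sum>k\<in>UNIV. h$k * (real (\<alpha> k) * mpow (v - a) (\<alpha>(k := \<alpha> k - 1)))) *\<^sub>R c \<alpha>" for \<alpha> v h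
  define M where "M \<alpha> = (N / d) * (mpow z \<alpha> * norm (c \<alpha>))" for \<alpha>
  define S where "S = ball w d"
  have S: "S \<subseteq> ball a r"
  proof
    fix v assume "v \<in> S"
    then have "norm (w - v) < d" by (simp add: S_def dist_norm)
    moreover have "1 \<le> N" using one_le_card_finite[where 'a='n] unfolding N_def by linarith
    then have "d * 1 \<le> d * (4 * N)" using d by (intro mult_left_mono) auto
    moreover have "d * (4 * N) = r - norm (w - a)" using N by (simp add: d_def)
    ultimately show "v \<in> ball a r"
      using norm_triangle_ineq4[of "w - a" "w - v"] by (simp add: dist_norm norm_minus_commute)
  qed
  have F: "((\<lambda>v. mpow (v - a) \<alpha> *\<^sub>R c \<alpha>) has_derivative F' \<alpha> v) (at v)" for \<alpha> v
    unfolding F'_def by (rule has_derivative_scaleR_left[OF has_derivative_mpow])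
  have M: "norm (F' \<alpha> v h) \<le> M \<alpha> * norm h" if "v \<in> S" for \<alpha> v h
  proof -
    have comp: "\<bar>(v - a)$k\<bar> \<le> (\<chi> k. y$k + d)$k" for k
    proof -
      have "\<bar>(v - w)$k\<bar> \<le> d"
        using component_le_norm_cart[of "v - w" k] that by (simp add: S_def dist_norm norm_minus_commute)
      then show ?thesis by (simp add: y_def)
    qed
    have b: "real (\<alpha> k) * \<bar>mpow (v - a) (\<alpha>(k := \<alpha> k - 1))\<bar> \<le> mpow z \<alpha> / d" for k
      using mpow_derivative_bound[OF comp d, of \<alpha> k] by (simp add: z_def algebra_simps)
    have "norm (F' \<alpha> v h) \<le> (\<Sum>k\<in>UNIV. \<bar>h$k * (real (\<alpha> k) * mpow (v - a) (\<alpha>(k := \<alpha> k - 1)))\<bar>) * norm (c \<alpha>)"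
      unfolding F'_def norm_scaleR by (intro mult_right_mono sum_abs) auto
    also have "\<dots> \<le> (\<Sum>k\<in>(UNIV::'n set). norm h * (mpow z \<alpha> / d)) * norm (c \<alpha>)"
      unfolding abs_mult abs_of_nat
      by (intro mult_right_mono sum_mono mult_mono b component_le_norm_cart) auto
    also have "\<dots> = M \<alpha> * norm h" by (simp add: M_def N_def)
    finally show ?thesis .
  qed
  have M0: "0 \<le> M \<alpha>" for \<alpha> using N d mz by (simp add: M_def)
  have Ms: "M summable_on UNIV" unfolding M_def using sm by (rule summable_on_cmult_right)
  have g: "((\<lambda>\<alpha>. mpow (v - a) \<alpha> *\<^sub>R c \<alpha>) has_sum f v) UNIV" if "v \<in> S" for v
    using ps S that by (auto simp: powser_def)
  have "convex S" "open S" "w \<in> S" using d by (auto simp: S_def)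
  note der = has_derivative_infsum[OF this F M0 Ms M g]
  let ?G = "\<lambda>h. \<Sum>\<^sub>\<infinity>\<alpha>. F' \<alpha> w h"
  have "((\<lambda>\<beta>. mpow (w - a) \<beta> *\<^sub>R dcoef k c \<beta>) has_sum ?G (axis k 1)) UNIV" for k
  proof -
    have "F' \<alpha> w (axis k 1) = (real (\<alpha> k) * mpow (w - a) (\<alpha>(k := \<alpha> k - 1))) *\<^sub>R c \<alpha>" for \<alpha>
      by (simp add: F'_def axis_def if_distrib[of "\<lambda>x. x * _"] cong: if_cong)
    then have "((\<lambda>\<alpha>. (real (\<alpha> k) * mpow (w - a) (\<alpha>(k := \<alpha> k - 1))) *\<^sub>R c \<alpha>) has_sum ?G (axis k 1)) UNIV"
      using der(2)[of "axis k 1"] by simp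
    then show ?thesis
      by (subst (asm) has_sum_shift_index[where k=k, symmetric]) (simp_all add: dcoef_def mult.commute)
  qed
  with der(1) show ?thesis by (rule that)
qed

lemma powser_center:
  assumes "powser c r a f" "0 < r"
  shows "f a = c (\<lambda>_. 0)"
proof -
  have "((\<lambda>\<alpha>. mpow 0 \<alpha> *\<^sub>R c \<alpha>) has_sum f a) UNIV" 
    using bspec[OF assms(1)[unfolded powser_def], of a] assms(2) by simp
  moreover have "((\<lambda>\<alpha>. mpow 0 \<alpha> *\<^sub>R c \<alpha>) has_sum c (\<lambda>_. 0)) UNIV"
    by (rule has_sum_finite_neutralI[of "{\<lambda>_. 0}"]) (auto simp: mpow_zero_vec)
  ultimately show ?thesis by (rule has_sum_unique)
qed

lemma powser_cong:
  assumes "powser c r a f" "\<And>w. w \<in> ball a r \<Longrightarrow> f w = g w"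
  shows "powser c r a g"
  using assms by (simp add: powser_def)

lemma powser_mono: "powser c r a f \<Longrightarrow> s \<le> r \<Longrightarrow> powser c s a f"
  by (auto simp: powser_def)

lemma powser_zero: "powser (\<lambda>_. 0) r a (\<lambda>_. 0)"
  by (simp add: powser_def)

lemma powser_add:
  assumes "powser c r a f" "powser d r a g"
  shows "powser (\<lambda>\<alpha>. c \<alpha> + d \<alpha>) r a (\<lambda>w. f w + g w)"
  using assms by (auto simp: powser_def scaleR_add_right intro!: has_sum_add)

lemma powser_bounded_linear:
  assumes "powser c r a f" "bounded_linear L"
  shows "powser (\<lambda>\<alpha>. L (c \<alpha>)) r a (\<lambda>w. L (f w))"
  unfolding powser_def
proof
  fix w assume "w \<in> ball a r"
  then have "((\<lambda>\<alpha>. mpow (w - a) \<alpha> *\<^sub>R c \<alpha>) has_sum f w) UNIV"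
    using assms(1) unfolding powser_def by blast
  from has_sum_bounded_linear[OF assms(2) this]
  show "((\<lambda>\<alpha>. mpow (w - a) \<alpha> *\<^sub>R L (c \<alpha>)) has_sum L (f w)) UNIV"
    by (simp add: linear_scale[OF bounded_linear.linear[OF assms(2)]])
qed

lemma powser_vanishing: 
  assumes "powser (\<lambda>_. 0) r a f" "w \<in> ball a r"
  shows "f w = 0"
proof -
  have "((\<lambda>\<alpha>. mpow (w - a) \<alpha> *\<^sub>R 0) has_sum f w) UNIV"
    using assms unfolding powser_def by blast
  then have "((\<lambda>\<alpha>. 0) has_sum f w) (UNIV :: ('a \<Rightarrow> nat) set)" by simp
  then show ?thesis using has_sum_0_simp by (rule has_sum_unique)
qed

lemma real_analytic_on_powser:
  "real_analytic_on f U \<longleftrightarrow> (\<forall>a\<in>U. \<exists>c r. 0 < r \<and> powser c r a f)"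
  by (simp add: real_analytic_on_def powser_def mpow_def)

section \<open>Partial derivatives as operations on coefficients\<close>

lemma partial_eq:
  assumes "(f has_derivative G) (at w)"
  shows "partial k f w = G (axis k 1)"
proof -
  have "((\<lambda>s. w + s *\<^sub>R axis k 1) has_derivative (\<lambda>s. s *\<^sub>R axis k 1)) (at 0)"
    by (auto intro!: derivative_eq_intros)
  moreover have "(f has_derivative G) (at (w + 0 *\<^sub>R axis k 1))" using assms by simp
  ultimately have "((\<lambda>s. f (w + s *\<^sub>R axis k 1)) has_derivative (\<lambda>s. G (s *\<^sub>R axis k 1))) (at 0)"
    by (rule has_derivative_compose)
  then have "((\<lambda>s. f (w + s *\<^sub>R axis k 1)) has_vector_derivative G (axis k 1)) (at 0)"
    by (simp add: has_vector_derivative_def linear_scale[OF has_derivative_linear[OF assms]])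
  then show ?thesis unfolding partial_def by (rule vector_derivative_at)
qed

lemma powser_partial:
  assumes "powser c r a f"
  shows "powser (dcoef k c) r a (partial k f)"
  unfolding powser_def
proof
  fix w assume "w \<in> ball a r"
  then obtain G where "(f has_derivative G) (at w)"
    "\<And>k. ((\<lambda>\<beta>. mpow (w - a) \<beta> *\<^sub>R dcoef k c \<beta>) has_sum G (axis k 1)) UNIV"
    using powser_has_derivative[OF assms] by blast
  then show "((\<lambda>\<beta>. mpow (w - a) \<beta> *\<^sub>R dcoef k c \<beta>) has_sum partial k f w) UNIV"
    using partial_eq by metis
qed

lemma real_analytic_on_partial: "real_analytic_on f U \<Longrightarrow> real_analytic_on (partial k f) U"
  unfolding real_analytic_on_powser using powser_partial by blast

lemma real_analytic_on_imp_continuous_on: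
  fixes f :: "real ^ 'n \<Rightarrow> 'b::euclidean_space"
  assumes "real_analytic_on f U"
  shows "continuous_on U f"
proof (rule continuous_at_imp_continuous_on, rule ballI)
  fix a assume "a \<in> U"
  with assms obtain c r where r: "0 < r" "powser c r a f" unfolding real_analytic_on_powser by blast
  have "a \<in> ball a r" using r(1) by simp
  then obtain G where "(f has_derivative G) (at a)" using powser_has_derivative[OF r(2)] by blast
  then show "isCont f a" by (rule has_derivative_continuous)
qed

definition mfact :: "('n::finite \<Rightarrow> nat) \<Rightarrow> real" where
  "mfact \<alpha> = (\<Prod>k\<in>UNIV. fact (\<alpha> k))"

lemma mfact_pos: "0 < mfact \<alpha>"
  by (simp add: mfact_def prod_pos)

lemma mfact_nonzero [simp]: "mfact \<alpha> \<noteq> 0"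
  by (simp add: mfact_def)

lemma mfact_Suc: "mfact (\<alpha>(k := Suc (\<alpha> k))) = real (Suc (\<alpha> k)) * mfact \<alpha>"
proof -
  have "mfact (\<alpha>(k := m)) = fact m * (\<Prod>j\<in>UNIV - {k}. fact (\<alpha> j))" for m
    unfolding mfact_def by (subst prod.remove[of _ k]) (auto intro!: prod.cong)
  from this[of "Suc (\<alpha> k)"] this[of "\<alpha> k"] show ?thesis by simp
qed

lemma mfact_pred: "\<alpha> k \<noteq> 0 \<Longrightarrow> mfact \<alpha> = real (\<alpha> k) * mfact (\<alpha>(k := \<alpha> k - 1))"
  using mfact_Suc[of "\<alpha>(k := \<alpha> k - 1)" k] by (simp del: of_nat_Suc)

text \<open>Includes the variable x_1, since uniqueness of power series needs all Taylor
  coefficients; for \<open>\<alpha> 1 = 0\<close> it is \<open>partial_multi\<close>.\<close>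

definition iter_partial :: "(4 \<Rightarrow> nat) \<Rightarrow> (real ^ 4 \<Rightarrow> real ^ 4) \<Rightarrow> real ^ 4 \<Rightarrow> real ^ 4" where
  "iter_partial \<alpha> f = (partial 1 ^^ \<alpha> 1) ((partial 2 ^^ \<alpha> 2) ((partial 3 ^^ \<alpha> 3) ((partial 4 ^^ \<alpha> 4) f)))"

lemma powser_partial_funpow:
  "powser c r a f \<Longrightarrow> powser ((dcoef k ^^ m) c) r a ((partial k ^^ m) f)"
  by (induction m) (auto intro: powser_partial)

lemma real_analytic_on_iter_partial:
  assumes "real_analytic_on f U"
  shows "real_analytic_on (iter_partial \<alpha> f) U"
proof -
  have "real_analytic_on ((partial k ^^ m) g) U" if "real_analytic_on g U" for k m g
    using that by (induction m) (auto intro: real_analytic_on_partial)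
  with assms show ?thesis by (simp add: iter_partial_def)
qed

lemma dcoef_funpow:
  "(dcoef k ^^ m) c \<alpha> = (fact (\<alpha> k + m) / fact (\<alpha> k)) *\<^sub>R c (\<alpha>(k := \<alpha> k + m))"
proof (induction m arbitrary: \<alpha>)
  case (Suc m)
  let ?n = "\<alpha> k"
  have "(dcoef k ^^ Suc m) c \<alpha> = real (Suc ?n) *\<^sub>R (dcoef k ^^ m) c (\<alpha>(k := Suc ?n))"
    by (simp only: funpow.simps o_apply dcoef_def[of k _ \<alpha>])
  also have "\<dots> = (real (Suc ?n) * (fact (Suc ?n + m) / fact (Suc ?n))) *\<^sub>R c (\<alpha>(k := ?n + Suc m))"
    by (simp add: Suc fun_upd_def del: fact_Suc of_nat_Suc cong: if_cong)
  also have "real (Suc ?n) * (fact (Suc ?n + m) / fact (Suc ?n)) = (fact (?n + Suc m) / fact ?n :: real)"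
    by (simp only: fact_Suc[of ?n] of_nat_Suc) (simp del: fact_Suc add: divide_simps)
  finally show ?case .
qed simp

text \<open>The iterated derivative is again the sum of a power series, so its value at the centre
  is the constant coefficient of that series.\<close>

lemma iter_partial_center:
  assumes "powser c r a f" "0 < r"
  shows "iter_partial \<alpha> f a = mfact \<alpha> *\<^sub>R c \<alpha>"
proof -
  let ?d = "(dcoef 1 ^^ \<alpha> 1) ((dcoef 2 ^^ \<alpha> 2) ((dcoef 3 ^^ \<alpha> 3) ((dcoef 4 ^^ \<alpha> 4) c)))"
  have "powser ?d r a (iter_partial \<alpha> f)"
    unfolding iter_partial_def by (intro powser_partial_funpow assms)
  then have "iter_partial \<alpha> f a = ?d (\<lambda>_. 0)" using assms(2) by (rule powser_center)
  also have "\<dots> = (fact (\<alpha> 1) * fact (\<alpha> 2) * fact (\<alpha> 3) * fact (\<alpha> 4)) *\<^sub>R c ((\<lambda>_. 0)(1 := \<alpha> 1, 2 := \<alpha> 2, 3 := \<alpha> 3, 4 := \<alpha> 4))"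
    using four_neq four_neq[symmetric] by (simp add: dcoef_funpow)
  also have "(\<lambda>_. 0)(1 := \<alpha> 1, 2 := \<alpha> 2, 3 := \<alpha> 3, 4 := \<alpha> 4) = \<alpha>"
  proof
    show "((\<lambda>_. 0)(1 := \<alpha> 1, 2 := \<alpha> 2, 3 := \<alpha> 3, 4 := \<alpha> 4)) k = \<alpha> k" for k
      using exhaust_4[of k] four_neq by auto
  qed
  also have "fact (\<alpha> 1) * fact (\<alpha> 2) * fact (\<alpha> 3) * fact (\<alpha> 4) = mfact \<alpha>"
    unfolding mfact_def UNIV_4 using four_neq by (simp add: mult.assoc)
  finally show ?thesis .
qed

section \<open>Uniqueness of coefficients and the identity theorem\<close>

lemma powser_unique:
  fixes f :: "real ^ 4 \<Rightarrow> real ^ 4"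
  assumes "powser c r a f" "powser d s a f" "0 < r" "0 < s"
  shows "c = d"
  using iter_partial_center[OF assms(1,3)] iter_partial_center[OF assms(2,4)] by (auto simp: fun_eq_iff)

text \<open>The set of points where all iterated derivatives vanish is closed in \<open>U\<close> by
  continuity, and open because a vanishing Taylor series makes \<open>h\<close> zero on a whole
  ball. Connectedness leaves only \<open>U\<close>.\<close>

lemma real_analytic_identity:
  fixes h :: "real ^ 4 \<Rightarrow> real ^ 4"
  assumes "open U" "connected U" and h: "real_analytic_on h U"
    and V: "open V" "p \<in> V" "V \<subseteq> U" "\<And>w. w \<in> V \<Longrightarrow> h w = 0" and "w \<in> U"
  shows "h w = 0"
proof -
  have local: "iter_partial \<alpha> h a = 0" if "0 < s" "\<And>v. v \<in> ball a s \<Longrightarrow> h v = 0" for \<alpha> a s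
  proof -
    have "powser (\<lambda>_. 0) s a h" using powser_zero by (rule powser_cong) (use that in auto)
    from iter_partial_center[OF this that(1)] show ?thesis by simp
  qed
  define S where "S = {w\<in>U. \<forall>\<alpha>. iter_partial \<alpha> h w = 0}"
  have zero: "\<exists>r>0. \<forall>v\<in>ball a r. h v = 0" if "a \<in> S" for a
  proof -
    obtain c r where r: "0 < r" "powser c r a h"
      using h \<open>a \<in> S\<close> unfolding real_analytic_on_powser S_def by blast
    have "c = (\<lambda>_. 0)"
      using iter_partial_center[OF r(2,1)] \<open>a \<in> S\<close> by (auto simp: S_def fun_eq_iff)
    then show ?thesis using r powser_vanishing by blast
  qed
  have "open S"
  proof (subst open_contains_ball, rule ballI)
    fix a assume a: "a \<in> S"
    then obtain r where r: "0 < r" "\<forall>v\<in>ball a r. h v = 0" using zero by blast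
    have "a \<in> U" using a by (simp add: S_def)
    then obtain e where e: "0 < e" "ball a e \<subseteq> U" using \<open>open U\<close> open_contains_ball by blast
    have "ball a (min r e) \<subseteq> S"
    proof
      fix v assume v: "v \<in> ball a (min r e)"
      moreover have "ball v (min r e - dist a v) \<subseteq> ball a r"
      proof
        fix u assume "u \<in> ball v (min r e - dist a v)"
        then show "u \<in> ball a r" using dist_triangle[of a u v] by (auto simp: mem_ball)
      qed
      ultimately have "iter_partial \<alpha> h v = 0" for \<alpha>
        using r(2) by (intro local[of "min r e - dist a v"]) auto
      with v e show "v \<in> S" by (auto simp: S_def)
    qed
    then show "\<exists>e>0. ball a e \<subseteq> S" using r(1) e(1) by (intro exI[of _ "min r e"]) auto
  qed
  then have "openin (top_of_set U) S" by (auto simp: S_def intro: open_subset)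
  moreover have "closedin (top_of_set U) S"
  proof -
    have "closedin (top_of_set U) (\<Inter>\<alpha>. {w\<in>U. iter_partial \<alpha> h w = 0})"
      using real_analytic_on_imp_continuous_on[OF real_analytic_on_iter_partial[OF h]]
      by (intro closedin_INT continuous_closedin_preimage_constant) auto
    moreover have "(\<Inter>\<alpha>. {w\<in>U. iter_partial \<alpha> h w = 0}) = S" by (auto simp: S_def)
    ultimately show ?thesis by simp
  qed
  moreover have "p \<in> S"
  proof -
    obtain e where "0 < e" "ball p e \<subseteq> V" using V(1,2) open_contains_ball by blast
    then have "iter_partial \<alpha> h p = 0" for \<alpha> using V(4) by (intro local[of e]) auto
    then show ?thesis using V by (auto simp: S_def)
  qed
  ultimately have "S = U" using \<open>connected U\<close> by (auto simp: connected_clopen)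
  with zero[of w] \<open>w \<in> U\<close> show ?thesis by force
qed

section \<open>Fueter polynomials\<close>

interpretation hmult: bounded_bilinear "hmult t" for t
  using bilinear_hmult by (simp add: bilinear_conv_bounded_bilinear)

definition eta_unit :: "real \<Rightarrow> 4 \<Rightarrow> real ^ 4" where
  "eta_unit t k = (if k = 2 then hi else - (sgn t / sqrt \<bar>t\<bar>) *\<^sub>R axis k 1)"

definition eta :: "real \<Rightarrow> 4 \<Rightarrow> real ^ 4 \<Rightarrow> real ^ 4" where
  "eta t k w = w$k *\<^sub>R h1 - w$1 *\<^sub>R eta_unit t k"

lemma etas_eq_eta: "eta2 = eta t 2" "eta3 t = eta t 3" "eta4 t = eta t 4"
  using four_neq four_neq[symmetric]
  by (auto simp: fun_eq_iff eta2_def eta3_def eta4_def eta_def eta_unit_def field_simps)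

lemma nabla_eq: "nabla t f w = partial 1 f w + (\<Sum>k\<in>{2,3,4}. hmult t (eta_unit t k) (partial k f w))"
  using four_neq four_neq[symmetric]
  by (simp add: nabla_def eta_unit_def hmult.scaleR_left hmult.scaleR_right hmult.minus_left)

lemma bounded_linear_eta: "bounded_linear (eta t k)"
  unfolding eta_def
  by (intro bounded_linear_sub bounded_linear_scaleR_left bounded_linear_vec_nth
      bounded_linear_compose[OF bounded_linear_scaleR_left])

text \<open>The value at \<open>\<alpha> - e\<^sub>k\<close>, taken to be \<open>0\<close> if that index is negative.\<close>

definition low :: "4 \<Rightarrow> ((4 \<Rightarrow> nat) \<Rightarrow> 'a::zero) \<Rightarrow> (4 \<Rightarrow> nat) \<Rightarrow> 'a" where
  "low k F \<alpha> = (if \<alpha> k = 0 then 0 else F (\<alpha>(k := \<alpha> k - 1)))"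

lemma low_commute: "low k (low l F) \<alpha> = low l (low k F) \<alpha>"
  by (cases "k = l") (auto simp: low_def fun_upd_twist)

lemma low_sum: "low k (\<lambda>\<beta>. \<Sum>l\<in>A. hmult t (a l) (G l \<beta>)) \<alpha> = (\<Sum>l\<in>A. hmult t (a l) (low k (G l) \<alpha>))"
  by (auto simp: low_def hmult.zero_right)

text \<open>The polynomials \<open>eta_pow\<close>, with the symmetrized product unfolded along its first factor.
  The degree is a separate argument so that the recursion is primitive.\<close>

primrec fueter :: "real \<Rightarrow> nat \<Rightarrow> (4 \<Rightarrow> nat) \<Rightarrow> real ^ 4 \<Rightarrow> real ^ 4" where
  "fueter t 0 = (\<lambda>\<alpha> w. if \<alpha> = (\<lambda>_. 0) then h1 else 0)"
| "fueter t (Suc N) = (\<lambda>\<alpha> w. (1 / real (Suc N)) *\<^sub>R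
     (\<Sum>k\<in>{2,3,4}. hmult t (eta t k w) (low k (\<lambda>\<beta>. fueter t N \<beta> w) \<alpha>)))"

text \<open>The recursion of \<open>fueter\<close> with the direction \<open>h\<close> in the first
  factor and without the prefactor. At \<open>h = w\<close> it gives \<open>Suc N\<close> times the
  polynomial, as Euler's identity demands of a derivative.\<close>

primrec dfueter :: "real \<Rightarrow> nat \<Rightarrow> (4 \<Rightarrow> nat) \<Rightarrow> real ^ 4 \<Rightarrow> real ^ 4 \<Rightarrow> real ^ 4" where
  "dfueter t 0 = (\<lambda>\<alpha> w h. 0)"
| "dfueter t (Suc N) = (\<lambda>\<alpha> w h. \<Sum>k\<in>{2,3,4}. hmult t (eta t k h) (low k (\<lambda>\<beta>. fueter t N \<beta> w) \<alpha>))"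

text \<open>Multiples of \<open>h1\<close> are central, so only the products of the units survive.
  Their coefficient does not depend on \<open>k\<close> and \<open>l\<close>, whence the
  antisymmetry.\<close>

lemma eta_commutator:
  "hmult t (eta t k w) (eta t l h) - hmult t (eta t l h) (eta t k w)
    = (w$1 * h$1) *\<^sub>R (hmult t (eta_unit t k) (eta_unit t l) - hmult t (eta_unit t l) (eta_unit t k))"
  unfolding eta_def
  by (simp add: hmult.diff_left hmult.diff_right hmult.scaleR_left hmult.scaleR_right
      hmult_unit_assoc algebra_simps)

text \<open>The commutator of \<open>eta t k w\<close> and \<open>eta t l h\<close> is antisymmetric in \<open>k\<close>, \<open>l\<close>.\<close>

lemma sum_eta_commute:
  assumes "\<And>k l. X k l = X l k"
  shows "(\<Sum>k\<in>A. \<Sum>l\<in>A. hmult t (eta t k w) (hmult t (eta t l h) (X k l)))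
       = (\<Sum>l\<in>A. \<Sum>k\<in>A. hmult t (eta t l h) (hmult t (eta t k w) (X k l)))"
proof -
  let ?E = "\<lambda>k l. hmult t (hmult t (eta_unit t k) (eta_unit t l)) (X k l)"
  let ?E' = "\<lambda>k l. hmult t (hmult t (eta_unit t l) (eta_unit t k)) (X k l)"
  have comm: "hmult t (eta t k w) (hmult t (eta t l h) (X k l)) - hmult t (eta t l h) (hmult t (eta t k w) (X k l))
      = (w$1 * h$1) *\<^sub>R (?E k l - ?E' k l)" for k l
  proof -
    have "hmult t (eta t k w) (hmult t (eta t l h) (X k l)) - hmult t (eta t l h) (hmult t (eta t k w) (X k l))
      = hmult t (hmult t (eta t k w) (eta t l h) - hmult t (eta t l h) (eta t k w)) (X k l)"
      by (simp only: hmult_unit_assoc hmult.diff_left)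
    then show ?thesis
      by (simp only: eta_commutator hmult.scaleR_left hmult.diff_left)
  qed
  have "(\<Sum>k\<in>A. \<Sum>l\<in>A. ?E' k l) = (\<Sum>l\<in>A. \<Sum>k\<in>A. ?E' k l)" by (rule sum.swap)
  also have "\<dots> = (\<Sum>k\<in>A. \<Sum>l\<in>A. ?E k l)"
    by (intro sum.cong refl) (simp only: assms)
  finally have swap: "(\<Sum>k\<in>A. \<Sum>l\<in>A. ?E' k l) = (\<Sum>k\<in>A. \<Sum>l\<in>A. ?E k l)" .
  have "(\<Sum>k\<in>A. \<Sum>l\<in>A. hmult t (eta t k w) (hmult t (eta t l h) (X k l)))
      - (\<Sum>k\<in>A. \<Sum>l\<in>A. hmult t (eta t l h) (hmult t (eta t k w) (X k l)))
      = (w$1 * h$1) *\<^sub>R ((\<Sum>k\<in>A. \<Sum>l\<in>A. ?E k l) - (\<Sum>k\<in>A. \<Sum>l\<in>A. ?E' k l))"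
    unfolding sum_subtractf[symmetric] comm scaleR_sum_right ..
  also have "\<dots> = 0" by (simp add: swap)
  finally have "(\<Sum>k\<in>A. \<Sum>l\<in>A. hmult t (eta t k w) (hmult t (eta t l h) (X k l)))
      = (\<Sum>k\<in>A. \<Sum>l\<in>A. hmult t (eta t l h) (hmult t (eta t k w) (X k l)))" by simp
  also have "\<dots> = (\<Sum>l\<in>A. \<Sum>k\<in>A. hmult t (eta t l h) (hmult t (eta t k w) (X k l)))" by (rule sum.swap)
  finally show ?thesis .
qed

lemma sum_eta_low:
  "(\<Sum>k\<in>{2,3,4}. hmult t (eta t k w) (low k (\<lambda>\<beta>. fueter t N \<beta> w) \<alpha>)) = real (Suc N) *\<^sub>R fueter t (Suc N) \<alpha> w"
  by simp

text \<open>The product rule for the recursion gives two sums. In the one that differentiates the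
  lower polynomial, the direction factor may be moved in front of \<open>eta t k w\<close> after
  summation, and the recursion folds the result to \<open>N\<close> times the claimed derivative.
  With the other sum this makes \<open>N + 1\<close> copies, which cancel the prefactor.\<close>

lemma has_derivative_fueter: "(fueter t N \<alpha> has_derivative dfueter t N \<alpha> w) (at w)"
proof (induction N arbitrary: \<alpha>)
  case 0
  show ?case by simp
next
  case (Suc N)
  let ?K = "{2,3,4} :: 4 set"
  let ?P = "\<lambda>N \<beta>. fueter t N \<beta> w"
  have low: "((\<lambda>w. low k (\<lambda>\<beta>. fueter t N \<beta> w) \<alpha>) has_derivative (\<lambda>h. low k (\<lambda>\<beta>. dfueter t N \<beta> w h) \<alpha>)) (at w)" for k
    by (cases "\<alpha> k = 0") (simp_all add: low_def Suc)
  have eta: "(eta t k has_derivative eta t k) (at w)" for k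
    by (rule bounded_linear_imp_has_derivative[OF bounded_linear_eta])
  have eq: "(\<Sum>k\<in>?K. hmult t (eta t k w) (low k (\<lambda>\<beta>. dfueter t N \<beta> w h) \<alpha>)) = real N *\<^sub>R dfueter t (Suc N) \<alpha> w h" for h
  proof (cases N)
    case 0
    then show ?thesis by (simp add: low_def hmult.zero_right)
  next
    case (Suc M)
    have "(\<Sum>k\<in>?K. hmult t (eta t k w) (low k (\<lambda>\<beta>. dfueter t N \<beta> w h) \<alpha>))
        = (\<Sum>k\<in>?K. \<Sum>l\<in>?K. hmult t (eta t k w) (hmult t (eta t l h) (low k (low l (?P M)) \<alpha>)))"
      by (simp only: Suc dfueter.simps low_sum hmult.sum_right)
    also have "\<dots> = (\<Sum>l\<in>?K. \<Sum>k\<in>?K. hmult t (eta t l h) (hmult t (eta t k w) (low k (low l (?P M)) \<alpha>)))"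
      by (rule sum_eta_commute) (rule low_commute)
    also have "\<dots> = (\<Sum>l\<in>?K. hmult t (eta t l h) (low l (\<lambda>\<beta>. \<Sum>k\<in>?K. hmult t (eta t k w) (low k (?P M) \<beta>)) \<alpha>))"
      by (simp only: low_sum hmult.sum_right low_commute[of _ _ "?P M"])
    also have "\<dots> = real N *\<^sub>R dfueter t (Suc N) \<alpha> w h"
      unfolding sum_eta_low
      by (auto simp: Suc low_def scaleR_sum_right hmult.scaleR_right hmult.zero_right
          simp del: fueter.simps sum.insert intro!: sum.cong)
    finally show ?thesis .
  qed
  have "(fueter t (Suc N) \<alpha> has_derivative (\<lambda>h. (1 / real (Suc N)) *\<^sub>R
     (\<Sum>k\<in>?K. hmult t (eta t k w) (low k (\<lambda>\<beta>. dfueter t N \<beta> w h) \<alpha>) + hmult t (eta t k h) (low k (?P N) \<alpha>)))) (at w)"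
    unfolding fueter.simps
    by (intro has_derivative_scaleR_right has_derivative_sum hmult.FDERIV eta low)
  moreover have "(1 / real (Suc N)) *\<^sub>R
     (\<Sum>k\<in>?K. hmult t (eta t k w) (low k (\<lambda>\<beta>. dfueter t N \<beta> w h) \<alpha>) + hmult t (eta t k h) (low k (?P N) \<alpha>))
     = dfueter t (Suc N) \<alpha> w h" for h
  proof -
    have "(1 / real (Suc N)) *\<^sub>R (real N *\<^sub>R X + X) = X" for X :: "real ^ 4"
    proof -
      have "real N *\<^sub>R X + X = real (Suc N) *\<^sub>R X" by (simp add: algebra_simps)
      then show ?thesis by simp
    qed
    then show ?thesis by (simp only: sum.distrib eq dfueter.simps)
  qed
  ultimately show ?case by (simp only:)
qed

lemma eta_axis:
  assumes "k \<in> {2,3,4}"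
  shows "eta t k (axis 1 1) = - eta_unit t k" "l \<in> {2,3,4} \<Longrightarrow> eta t k (axis l 1) = (if l = k then h1 else 0)"
  using assms four_neq four_neq[symmetric] by (auto simp: eta_def axis_def)

text \<open>Along x_l the derivative is the polynomial with index lowered at \<open>l\<close>; along
  x_1 it is minus the sum of the units times these polynomials. The two parts of the operator
  cancel.\<close>

lemma dfueter_regular:
  "dfueter t N \<alpha> w (axis 1 1) + (\<Sum>k\<in>{2,3,4}. hmult t (eta_unit t k) (dfueter t N \<alpha> w (axis k 1))) = 0"
proof (cases N)
  case (Suc M)
  let ?L = "\<lambda>k. low k (\<lambda>\<beta>. fueter t M \<beta> w) \<alpha>"
  have "dfueter t N \<alpha> w (axis 1 1) = - (\<Sum>k\<in>{2,3,4}. hmult t (eta_unit t k) (?L k))"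
    by (simp only: Suc dfueter.simps eta_axis hmult.minus_left sum_negf cong: sum.cong)
  moreover have "dfueter t N \<alpha> w (axis l 1) = ?L l" if "l \<in> {2,3,4}" for l
  proof -
    have "dfueter t N \<alpha> w (axis l 1) = (\<Sum>k\<in>{2,3,4}. if k = l then ?L k else 0)"
      unfolding Suc dfueter.simps
      by (intro sum.cong refl) (use that in \<open>auto simp: eta_axis hmult_unit_assoc hmult.zero_left simp del: insert_iff\<close>)
    then show ?thesis using that by (simp add: sum.delta)
  qed
  ultimately show ?thesis by (simp cong: sum.cong)
qed (simp add: hmult.zero_right)

section \<open>Growth of the polynomials and of their derivatives\<close>

lemma norm_hmult_eta_le:
  obtains Q where "0 < Q" "\<And>k w x. norm (hmult t (eta t k w) x) \<le> Q * norm w * norm x"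
proof -
  obtain C where C: "0 < C" "\<And>x y. norm (hmult t x y) \<le> norm x * norm y * C"
    using hmult.pos_bounded by blast
  \<comment> \<open>The coordinate w_k contributes 1, and the unit, multiplied by w_1, contributes
    at most 1 + 1 / sqrt |t|.\<close>
  define B where "B = 2 + 1 / sqrt \<bar>t\<bar>"
  have B: "0 < B" by (simp add: B_def add_pos_nonneg)
  have "norm (eta_unit t k) \<le> 1 + 1 / sqrt \<bar>t\<bar>" for k
    by (simp add: eta_unit_def norm_axis_1 sgn_if)
  then have "\<bar>w$k\<bar> + \<bar>w$1\<bar> * norm (eta_unit t k) \<le> norm w + norm w * (1 + 1 / sqrt \<bar>t\<bar>)" for w k
    by (intro add_mono mult_mono component_le_norm_cart) auto
  moreover have "norm (eta t k w) \<le> \<bar>w$k\<bar> + \<bar>w$1\<bar> * norm (eta_unit t k)" for k w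
    using norm_triangle_ineq4[of "w$k *\<^sub>R h1" "w$1 *\<^sub>R eta_unit t k"] by (simp add: eta_def norm_axis_1)
  ultimately have eta: "norm (eta t k w) \<le> norm w + norm w * (1 + 1 / sqrt \<bar>t\<bar>)" for k w
    by (rule order_trans[rotated])
  have "norm (hmult t (eta t k w) x) \<le> (C * B) * norm w * norm x" for k w x
  proof -
    have "norm (eta t k w) * norm x * C \<le> (norm w + norm w * (1 + 1 / sqrt \<bar>t\<bar>)) * norm x * C"
      using C eta by (intro mult_right_mono) auto
    also have "\<dots> = (C * B) * norm w * norm x" by (simp add: B_def algebra_simps)
    finally show ?thesis using C(2) order_trans by blast
  qed
  with B C(1) that[of "C * B"] show ?thesis by simp
qed

text \<open>Lowering entry \<open>k\<close> turns 1 / \<alpha>! into \<alpha>_k / \<alpha>!, and the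
  entries \<alpha>_k add up to at most N + 1. With a free \<open>h\<close> the estimate serves both
  the polynomial and its derivative.\<close>

lemma sum_norm_low_le:
  assumes Q: "0 < Q" "\<And>k w x. norm (hmult t (eta t k w) x) \<le> Q * norm w * norm x"
    and IH: "\<And>\<beta>. (\<Sum>k\<in>{2,3,4}. \<beta> k) \<le> N \<Longrightarrow> norm (fueter t N \<beta> w) \<le> (Q * norm w) ^ N / mfact \<beta>"
    and \<alpha>: "(\<Sum>k\<in>{2,3,4}. \<alpha> k) \<le> Suc N"
  shows "norm (\<Sum>k\<in>{2,3,4}. hmult t (eta t k h) (low k (\<lambda>\<beta>. fueter t N \<beta> w) \<alpha>))
      \<le> real (Suc N) * (Q * norm h * (Q * norm w) ^ N / mfact \<alpha>)"
proof -
  let ?b = "Q * norm h * (Q * norm w) ^ N / mfact \<alpha>"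
  have b: "0 \<le> ?b" using Q(1) mfact_pos[of \<alpha>] by simp
  have "norm (hmult t (eta t k h) (low k (\<lambda>\<beta>. fueter t N \<beta> w) \<alpha>)) \<le> real (\<alpha> k) * ?b" if "k \<in> {2,3,4}" for k
  proof (cases "\<alpha> k = 0")
    case True
    then show ?thesis by (simp add: low_def hmult.zero_right)
  next
    case False
    let ?\<beta> = "\<alpha>(k := \<alpha> k - 1)"
    have "(\<Sum>k\<in>{2,3,4}. ?\<beta> k) < (\<Sum>k\<in>{2,3,4}. \<alpha> k)"
      using that False by (intro sum_strict_mono_ex1) auto
    then have "(\<Sum>k\<in>{2,3,4}. ?\<beta> k) \<le> N" using \<alpha> by simp
    note IH[of ?\<beta>, OF this]
    then have "Q * norm h * norm (fueter t N ?\<beta> w) \<le> Q * norm h * ((Q * norm w) ^ N / mfact ?\<beta>)"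
      using Q(1) by (intro mult_left_mono) auto
    also have "\<dots> = real (\<alpha> k) * ?b"
      using mfact_pred[of \<alpha> k] False mfact_pos[of ?\<beta>] by (simp add: field_simps)
    finally have "Q * norm h * norm (fueter t N ?\<beta> w) \<le> real (\<alpha> k) * ?b" .
    with Q(2)[of k h "fueter t N ?\<beta> w"] show ?thesis
      using False by (simp add: low_def)
  qed
  then have "norm (\<Sum>k\<in>{2,3,4}. hmult t (eta t k h) (low k (\<lambda>\<beta>. fueter t N \<beta> w) \<alpha>))
      \<le> (\<Sum>k\<in>{2,3,4}. real (\<alpha> k) * ?b)"
    by (rule sum_norm_le)
  also have "\<dots> = real (\<Sum>k\<in>{2,3,4}. \<alpha> k) * ?b"
    by (simp only: sum_distrib_right of_nat_sum)
  also have "\<dots> \<le> real (Suc N) * ?b"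
    using b \<alpha> by (intro mult_right_mono of_nat_mono)
  finally show ?thesis .
qed

text \<open>The factor \<open>Suc N\<close> of the preceding estimate is cancelled by the prefactor
  of the recursion, so the full 1 / \<alpha>! survives; it has to balance the factorial in the
  coefficients of the series.\<close>

lemma norm_fueter_le:
  assumes Q: "0 < Q" "\<And>k w x. norm (hmult t (eta t k w) x) \<le> Q * norm w * norm x"
    and "(\<Sum>k\<in>{2,3,4}. \<alpha> k) \<le> N"
  shows "norm (fueter t N \<alpha> w) \<le> (Q * norm w) ^ N / mfact \<alpha>"
  using assms(3)
proof (induction N arbitrary: \<alpha>)
  case 0
  show ?case using mfact_pos[of \<alpha>] by (auto simp: norm_axis_1 mfact_def)
next
  case (Suc N)
  have "norm (fueter t (Suc N) \<alpha> w)
      = norm (\<Sum>k\<in>{2,3,4}. hmult t (eta t k w) (low k (\<lambda>\<beta>. fueter t N \<beta> w) \<alpha>)) / real (Suc N)"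
    by (simp del: sum.insert of_nat_Suc)
  also have "\<dots> \<le> real (Suc N) * (Q * norm w * (Q * norm w) ^ N / mfact \<alpha>) / real (Suc N)"
    by (intro divide_right_mono sum_norm_low_le Q Suc) auto
  finally show ?case by (simp del: of_nat_Suc)
qed

text \<open>Without the prefactor of \<open>fueter\<close> the factor \<open>real N\<close> remains.
  At \<open>N = 0\<close> both sides are 0, so the truncated exponent does no harm.\<close>

lemma norm_dfueter_le:
  assumes Q: "0 < Q" "\<And>k w x. norm (hmult t (eta t k w) x) \<le> Q * norm w * norm x"
    and "(\<Sum>k\<in>{2,3,4}. \<alpha> k) \<le> N"
  shows "norm (dfueter t N \<alpha> w h) \<le> real N * (Q * norm h * (Q * norm w) ^ (N - 1) / mfact \<alpha>)"
proof (cases N)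
  case (Suc M)
  show ?thesis unfolding Suc dfueter.simps diff_Suc_1
    by (rule sum_norm_low_le[OF Q norm_fueter_le[OF Q]]) (use assms(3) Suc in auto)
qed simp

section \<open>From the symmetrized product to the recursion\<close>

lemma sum_permutes_eq_sum_permutations_of_set:
  "(\<Sum>\<sigma> | \<sigma> permutes {..<N}. g (map \<sigma> [0..<N])) = (\<Sum>xs\<in>permutations_of_set {..<N}. g xs)"
proof (rule sum.reindex_bij_betw[of "\<lambda>\<sigma>. map \<sigma> [0..<N]"])
  have inj: "inj_on (\<lambda>\<sigma>. map \<sigma> [0..<N]) {\<sigma>. \<sigma> permutes {..<N}}"
  proof (rule inj_onI)
    fix \<sigma> \<tau> assume st: "\<sigma> \<in> {\<sigma>. \<sigma> permutes {..<N}}" "\<tau> \<in> {\<sigma>. \<sigma> permutes {..<N}}" "map \<sigma> [0..<N] = map \<tau> [0..<N]"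
    show "\<sigma> = \<tau>"
    proof
      fix i show "\<sigma> i = \<tau> i"
        using st by (cases "i < N") (auto simp: permutes_def)
    qed
  qed
  have sub: "(\<lambda>\<sigma>. map \<sigma> [0..<N]) ` {\<sigma>. \<sigma> permutes {..<N}} \<subseteq> permutations_of_set {..<N}"
    by (auto simp: permutations_of_set_def atLeast0LessThan permutes_image distinct_map dest: permutes_inj_on)
  \<comment> \<open>Surjectivity is obtained by counting: both sets have N! elements.\<close>
  have "card ((\<lambda>\<sigma>. map \<sigma> [0..<N]) ` {\<sigma>. \<sigma> permutes {..<N}}) = card (permutations_of_set {..<N})"
    using card_image[OF inj] card_permutations[of "{..<N}" N] by simp
  then show "bij_betw (\<lambda>\<sigma>. map \<sigma> [0..<N]) {\<sigma>. \<sigma> permutes {..<N}} (permutations_of_set {..<N})"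
    using inj sub card_subset_eq[OF finite_permutations_of_set sub] by (simp add: bij_betw_def)
qed

lemma sum_permutations_of_set_Cons:
  assumes "finite A" "A \<noteq> {}"
  shows "(\<Sum>xs\<in>permutations_of_set A. g xs) = (\<Sum>x\<in>A. \<Sum>xs\<in>permutations_of_set (A - {x}). g (x # xs))"
  unfolding permutations_of_set_nonempty[OF assms(2)]
  using assms(1) by (subst sum.UNION_disjoint) (auto simp: sum.reindex)

text \<open>Elements of \<open>A\<close> are the positions of the factors and \<open>g\<close> tells
  which eta stands there. An arbitrary finite \<open>A\<close> is needed because splitting off the
  first factor removes an arbitrary position.\<close>

lemma sum_permutations_fueter:
  fixes g :: "'a \<Rightarrow> 4"
  assumes "finite A" "\<And>i. i \<in> A \<Longrightarrow> g i \<in> {2,3,4}"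
  shows "(\<Sum>xs\<in>permutations_of_set A. foldr (hmult t) (map (\<lambda>i. eta t (g i) w) xs) h1)
    = (fact (card A) * mfact (\<lambda>k. card {i\<in>A. g i = k})) *\<^sub>R fueter t (card A) (\<lambda>k. card {i\<in>A. g i = k}) w"
  using assms
proof (induction "card A" arbitrary: A)
  case 0
  then show ?case by (simp add: mfact_def)
next
  case (Suc N)
  let ?cnt = "\<lambda>A k. card {i\<in>A. g i = k}"
  have A: "A \<noteq> {}" using Suc.hyps(2) by auto
  have "(\<Sum>xs\<in>permutations_of_set A. foldr (hmult t) (map (\<lambda>i. eta t (g i) w) xs) h1)
      = (\<Sum>i\<in>A. hmult t (eta t (g i) w) (\<Sum>xs\<in>permutations_of_set (A - {i}). foldr (hmult t) (map (\<lambda>i. eta t (g i) w) xs) h1))"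
    by (subst sum_permutations_of_set_Cons[OF Suc.prems(1) A]) (simp add: hmult.sum_right)
  also have "\<dots> = (\<Sum>i\<in>A. (fact N * mfact (?cnt A) / real (?cnt A (g i))) *\<^sub>R
      hmult t (eta t (g i) w) (low (g i) (\<lambda>\<beta>. fueter t N \<beta> w) (?cnt A)))"
  proof (intro sum.cong refl)
    fix i assume i: "i \<in> A"
    have card: "card (A - {i}) = N" using Suc i by simp
    have pos: "?cnt A (g i) \<noteq> 0" using i Suc.prems by auto
    have cnt: "?cnt (A - {i}) = (?cnt A)(g i := ?cnt A (g i) - 1)"
    proof
      fix k show "?cnt (A - {i}) k = ((?cnt A)(g i := ?cnt A (g i) - 1)) k"
      proof (cases "k = g i")
        case True
        have "{j\<in>A - {i}. g j = g i} = {j\<in>A. g j = g i} - {i}" by auto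
        then show ?thesis using i True Suc.prems(1) by simp
      next
        case False
        then have "{j\<in>A - {i}. g j = k} = {j\<in>A. g j = k}" by auto
        with False show ?thesis by simp
      qed
    qed
    have "(\<Sum>xs\<in>permutations_of_set (A - {i}). foldr (hmult t) (map (\<lambda>i. eta t (g i) w) xs) h1)
      = (fact N * mfact (?cnt (A - {i}))) *\<^sub>R fueter t N (?cnt (A - {i})) w"
      using Suc.hyps(1)[of "A - {i}"] Suc.prems card by simp
    also have "mfact (?cnt (A - {i})) = mfact (?cnt A) / real (?cnt A (g i))"
      using mfact_pred[of "?cnt A" "g i", OF pos] pos by (simp only: cnt) (simp add: field_simps)
    also have "fueter t N (?cnt (A - {i})) w = low (g i) (\<lambda>\<beta>. fueter t N \<beta> w) (?cnt A)"
      unfolding cnt using pos by (simp only: low_def if_False)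
    finally show "hmult t (eta t (g i) w) (\<Sum>xs\<in>permutations_of_set (A - {i}). foldr (hmult t) (map (\<lambda>i. eta t (g i) w) xs) h1)
      = (fact N * mfact (?cnt A) / real (?cnt A (g i))) *\<^sub>R hmult t (eta t (g i) w) (low (g i) (\<lambda>\<beta>. fueter t N \<beta> w) (?cnt A))"
      by (simp add: hmult.scaleR_right)
  qed
  \<comment> \<open>Positions with the same label \<open>k\<close> contribute equally, and their
    number \<open>?cnt A k\<close> cancels the denominator. If there are none, \<open>low\<close>
    gives 0.\<close>
  also have "\<dots> = (\<Sum>k\<in>{2,3,4}. \<Sum>i | i \<in> A \<and> g i = k. (fact N * mfact (?cnt A) / real (?cnt A (g i))) *\<^sub>R
      hmult t (eta t (g i) w) (low (g i) (\<lambda>\<beta>. fueter t N \<beta> w) (?cnt A)))"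
    by (rule sum.group[symmetric]) (use Suc.prems in auto)
  also have "\<dots> = (\<Sum>k\<in>{2,3,4}. (fact N * mfact (?cnt A)) *\<^sub>R hmult t (eta t k w) (low k (\<lambda>\<beta>. fueter t N \<beta> w) (?cnt A)))"
  proof (intro sum.cong refl)
    fix k
    have "(\<Sum>i | i \<in> A \<and> g i = k. (fact N * mfact (?cnt A) / real (?cnt A (g i))) *\<^sub>R
        hmult t (eta t (g i) w) (low (g i) (\<lambda>\<beta>. fueter t N \<beta> w) (?cnt A)))
      = (\<Sum>i | i \<in> A \<and> g i = k. (fact N * mfact (?cnt A) / real (?cnt A k)) *\<^sub>R
        hmult t (eta t k w) (low k (\<lambda>\<beta>. fueter t N \<beta> w) (?cnt A)))"
      by (intro sum.cong refl) auto
    also have "\<dots> = (fact N * mfact (?cnt A)) *\<^sub>R hmult t (eta t k w) (low k (\<lambda>\<beta>. fueter t N \<beta> w) (?cnt A))"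
      by (cases "?cnt A k = 0") (simp_all add: sum_constant_scaleR low_def hmult.zero_right del: sum_constant)
    finally show "(\<Sum>i | i \<in> A \<and> g i = k. (fact N * mfact (?cnt A) / real (?cnt A (g i))) *\<^sub>R
        hmult t (eta t (g i) w) (low (g i) (\<lambda>\<beta>. fueter t N \<beta> w) (?cnt A)))
      = (fact N * mfact (?cnt A)) *\<^sub>R hmult t (eta t k w) (low k (\<lambda>\<beta>. fueter t N \<beta> w) (?cnt A))" .
  qed
  also have "\<dots> = (fact N * mfact (?cnt A)) *\<^sub>R (real (Suc N) *\<^sub>R fueter t (Suc N) (?cnt A) w)"
    by (simp only: scaleR_sum_right[symmetric] sum_eta_low)
  finally show ?case
    unfolding Suc.hyps(2)[symmetric] by (simp add: fact_Suc mult_ac del: fueter.simps of_nat_Suc)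
qed

definition multi_idx :: "nat \<times> nat \<times> nat \<Rightarrow> 4 \<Rightarrow> nat" where
  "multi_idx = (\<lambda>(n1, n2, n3). (\<lambda>_. 0)(2 := n1, 3 := n2, 4 := n3))"

definition deg :: "nat \<times> nat \<times> nat \<Rightarrow> nat" where
  "deg = (\<lambda>(n1, n2, n3). n1 + n2 + n3)"

text \<open>The sum over permutations equals N! n! times the polynomial; the normalizations of
  \<open>sym_prod\<close> and of \<open>eta_pow\<close> remove exactly these two factors.\<close>

lemma eta_pow_eq_fueter: "eta_pow t n w = fueter t (deg n) (multi_idx n) w"
proof -
  obtain n1 n2 n3 where n: "n = (n1, n2, n3)" by (cases n)
  define ks :: "4 list" where "ks = replicate n1 2 @ replicate n2 3 @ replicate n3 4"
  define N where "N = length ks"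
  have N: "N = deg n" by (simp add: N_def ks_def n deg_def)
  have ks: "ks ! i \<in> {2,3,4}" if "i < N" for i
    using nth_mem[of i ks] that by (auto simp: N_def ks_def)
  have cnt: "(\<lambda>k. card {i\<in>{..<N}. ks ! i = k}) = multi_idx n"
  proof
    fix k
    have "card {i\<in>{..<N}. ks ! i = k} = length (filter (\<lambda>x. x = k) ks)"
      by (simp add: length_filter_conv_card N_def)
    also have "\<dots> = multi_idx n k"
      using exhaust_4[of k] four_neq four_neq[symmetric] by (auto simp: ks_def multi_idx_def n)
    finally show "card {i\<in>{..<N}. ks ! i = k} = multi_idx n k" .
  qed
  have fs: "replicate n1 eta2 @ replicate n2 (eta3 t) @ replicate n3 (eta4 t) = map (eta t) ks"
    by (simp add: ks_def etas_eq_eta)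
  have mf: "mfact (multi_idx n) = fact n1 * fact n2 * fact n3"
    unfolding mfact_def UNIV_4 using four_neq four_neq[symmetric] by (simp add: multi_idx_def n mult_ac)
  have "sym_prod t (map (eta t) ks) w
      = (1 / fact N) *\<^sub>R (\<Sum>\<sigma> | \<sigma> permutes {..<N}. foldr (hmult t) (map (\<lambda>m. eta t (ks ! m) w) (map \<sigma> [0..<N])) h1)"
    unfolding sym_prod_def length_map N_def[symmetric]
  proof (intro arg_cong[where f="\<lambda>x. _ *\<^sub>R x"] sum.cong refl arg_cong[where f="\<lambda>xs. foldr _ xs _"])
    fix \<sigma> assume "\<sigma> \<in> {\<sigma>. \<sigma> permutes {..<N}}"
    then have "\<sigma> m < N" if "m < N" for m using permutes_in_image[of \<sigma> "{..<N}" m] that by simp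
    then show "map (\<lambda>m. (map (eta t) ks ! \<sigma> m) w) [0..<N] = map (\<lambda>m. eta t (ks ! m) w) (map \<sigma> [0..<N])"
      by (auto simp: N_def)
  qed
  also have "\<dots> = (1 / fact N) *\<^sub>R (\<Sum>xs\<in>permutations_of_set {..<N}. foldr (hmult t) (map (\<lambda>m. eta t (ks ! m) w) xs) h1)"
    by (subst sum_permutes_eq_sum_permutations_of_set) simp
  also have "\<dots> = mfact (multi_idx n) *\<^sub>R fueter t N (multi_idx n) w"
    using sum_permutations_fueter[of "{..<N}" "\<lambda>i. ks ! i" t w] ks unfolding cnt by simp
  finally show ?thesis
    unfolding n eta_pow_def prod.case fs by (simp add: mf[unfolded n, symmetric] n N)
qed

section \<open>Homogeneous parts of regular power series\<close>

text \<open>Two supports occur: \<open>UNIV\<close> for the monomials of the Taylor series,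
  \<open>{2,3,4}\<close> for the indices of the polynomials \<open>eta_pow\<close>.\<close>

definition degset :: "'n set \<Rightarrow> nat \<Rightarrow> ('n::finite \<Rightarrow> nat) set" where
  "degset J N = {\<alpha>. (\<forall>k. k \<notin> J \<longrightarrow> \<alpha> k = 0) \<and> (\<Sum>k\<in>J. \<alpha> k) = N}"

lemma finite_degset [simp]: "finite (degset J N)"
proof (rule finite_subset)
  show "degset J N \<subseteq> PiE UNIV (\<lambda>_. {..N})"
  proof
    fix \<alpha> assume \<alpha>: "\<alpha> \<in> degset J N"
    have "\<alpha> k \<le> N" for k
    proof (cases "k \<in> J")
      case True
      then show ?thesis using \<alpha> member_le_sum[of k J \<alpha>] by (auto simp: degset_def)
    next
      case False
      then show ?thesis using \<alpha> by (auto simp: degset_def)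
    qed
    then show "\<alpha> \<in> PiE UNIV (\<lambda>_. {..N})" by auto
  qed
qed (rule finite_PiE, auto)

lemma degset_Suc_iff:
  assumes "k \<in> J"
  shows "\<beta>(k := Suc (\<beta> k)) \<in> degset J (Suc N) \<longleftrightarrow> \<beta> \<in> degset J N"
proof -
  have "(\<Sum>j\<in>J. (\<beta>(k := m)) j) = m + (\<Sum>j\<in>J - {k}. \<beta> j)" for m
    using assms by (subst sum.remove[of _ k]) (auto intro!: sum.cong)
  from this[of "Suc (\<beta> k)"] this[of "\<beta> k"] show ?thesis
    using assms by (auto simp: degset_def)
qed

lemma sum_degset_shift:
  fixes F :: "('n::finite \<Rightarrow> nat) \<Rightarrow> 'b::comm_monoid_add"
  assumes "k \<in> J" "\<And>\<alpha>. \<alpha> k = 0 \<Longrightarrow> F \<alpha> = 0"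
  shows "(\<Sum>\<alpha>\<in>degset J (Suc N). F \<alpha>) = (\<Sum>\<beta>\<in>degset J N. F (\<beta>(k := Suc (\<beta> k))))"
proof -
  have "(\<Sum>\<alpha>\<in>degset J (Suc N). F \<alpha>) = (\<Sum>\<alpha>\<in>{\<alpha>\<in>degset J (Suc N). \<alpha> k \<noteq> 0}. F \<alpha>)"
    by (rule sum.mono_neutral_right) (use assms(2) in auto)
  also have "\<dots> = (\<Sum>\<beta>\<in>degset J N. F (\<beta>(k := Suc (\<beta> k))))"
  proof (rule sum.reindex_bij_witness[where i="\<lambda>\<beta>. \<beta>(k := Suc (\<beta> k))" and j="\<lambda>\<alpha>. \<alpha>(k := \<alpha> k - 1)"])
    fix \<alpha> assume \<alpha>: "\<alpha> \<in> {\<alpha>\<in>degset J (Suc N). \<alpha> k \<noteq> 0}"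
    show 1: "(\<alpha>(k := \<alpha> k - 1))(k := Suc ((\<alpha>(k := \<alpha> k - 1)) k)) = \<alpha>" using \<alpha> by auto
    show "\<alpha>(k := \<alpha> k - 1) \<in> degset J N"
      using degset_Suc_iff[OF assms(1), of "\<alpha>(k := \<alpha> k - 1)" N] \<alpha> unfolding 1 by blast
    show "F ((\<alpha>(k := \<alpha> k - 1))(k := Suc ((\<alpha>(k := \<alpha> k - 1)) k))) = F \<alpha>" unfolding 1 ..
  next
    fix \<beta> assume "\<beta> \<in> degset J N"
    then show "\<beta>(k := Suc (\<beta> k)) \<in> {\<alpha>\<in>degset J (Suc N). \<alpha> k \<noteq> 0}"
      using degset_Suc_iff[OF assms(1)] by auto
    show "(\<beta>(k := Suc (\<beta> k)))(k := (\<beta>(k := Suc (\<beta> k))) k - 1) = \<beta>" by auto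
  qed
  finally show ?thesis .
qed

definition homog :: "(('n::finite \<Rightarrow> nat) \<Rightarrow> 'b::real_vector) \<Rightarrow> nat \<Rightarrow> real ^ 'n \<Rightarrow> 'b" where
  "homog c N w = (\<Sum>\<alpha>\<in>degset UNIV N. mpow w \<alpha> *\<^sub>R c \<alpha>)"

text \<open>Euler's identity on coefficients: the weight N + 1 is distributed as the sum of the
  exponents, and each exponent \<open>\<alpha> k\<close> is absorbed into \<open>dcoef k\<close> by
  a shift of index.\<close>

lemma homog_euler:
  fixes c :: "('n::finite \<Rightarrow> nat) \<Rightarrow> 'b::real_vector"
  shows "real (Suc N) *\<^sub>R homog c (Suc N) w = (\<Sum>k\<in>UNIV. w$k *\<^sub>R homog (dcoef k c) N w)"
proof -
  have "real (Suc N) *\<^sub>R homog c (Suc N) w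
      = (\<Sum>\<alpha>\<in>degset UNIV (Suc N). \<Sum>k\<in>UNIV. real (\<alpha> k) *\<^sub>R mpow w \<alpha> *\<^sub>R c \<alpha>)"
    unfolding homog_def scaleR_sum_right
  proof (intro sum.cong refl)
    fix \<alpha> :: "'n \<Rightarrow> nat" assume "\<alpha> \<in> degset UNIV (Suc N)"
    then have "Suc N = (\<Sum>k\<in>UNIV. \<alpha> k)" by (simp add: degset_def)
    then show "real (Suc N) *\<^sub>R mpow w \<alpha> *\<^sub>R c \<alpha> = (\<Sum>k\<in>UNIV. real (\<alpha> k) *\<^sub>R mpow w \<alpha> *\<^sub>R c \<alpha>)"
      by (simp only: scaleR_sum_left[symmetric] of_nat_sum)
  qed
  also have "\<dots> = (\<Sum>k\<in>UNIV. \<Sum>\<alpha>\<in>degset UNIV (Suc N). real (\<alpha> k) *\<^sub>R mpow w \<alpha> *\<^sub>R c \<alpha>)"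
    by (rule sum.swap)
  also have "\<dots> = (\<Sum>k\<in>UNIV. w$k *\<^sub>R homog (dcoef k c) N w)"
  proof (intro sum.cong refl)
    fix k
    have "(\<Sum>\<alpha>\<in>degset UNIV (Suc N). real (\<alpha> k) *\<^sub>R mpow w \<alpha> *\<^sub>R c \<alpha>)
        = (\<Sum>\<beta>\<in>degset UNIV N. real (Suc (\<beta> k)) *\<^sub>R mpow w (\<beta>(k := Suc (\<beta> k))) *\<^sub>R c (\<beta>(k := Suc (\<beta> k))))"
      by (subst sum_degset_shift[of k]) auto
    also have "\<dots> = w$k *\<^sub>R homog (dcoef k c) N w"
      by (simp add: homog_def mpow_Suc dcoef_def scaleR_sum_right mult_ac del: of_nat_Suc)
    finally show "(\<Sum>\<alpha>\<in>degset UNIV (Suc N). real (\<alpha> k) *\<^sub>R mpow w \<alpha> *\<^sub>R c \<alpha>) = w$k *\<^sub>R homog (dcoef k c) N w" .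
  qed
  finally show ?thesis .
qed

definition regular_coef :: "real \<Rightarrow> ((4 \<Rightarrow> nat) \<Rightarrow> real ^ 4) \<Rightarrow> (4 \<Rightarrow> nat) \<Rightarrow> real ^ 4" where
  "regular_coef t c \<alpha> = dcoef 1 c \<alpha> + (\<Sum>k\<in>{2,3,4}. hmult t (eta_unit t k) (dcoef k c \<alpha>))"

lemma dcoef_commute: "dcoef j (dcoef k c) \<alpha> = dcoef k (dcoef j c) \<alpha>"
  by (cases "j = k") (auto simp: dcoef_def fun_upd_twist mult_ac)

text \<open>The operators \<open>dcoef\<close> commute with each other and with left multiplication
  by constants. This keeps the induction on the degree inside the regular series.\<close>

lemma regular_coef_dcoef:
  assumes "\<And>\<alpha>. regular_coef t c \<alpha> = 0"
  shows "regular_coef t (dcoef j c) \<alpha> = 0"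
proof -
  have "regular_coef t (dcoef j c) \<alpha> = dcoef j (regular_coef t c) \<alpha>"
    unfolding regular_coef_def dcoef_commute[of _ j]
    by (simp add: dcoef_def[of j] scaleR_add_right hmult.scaleR_right)
  then show ?thesis by (simp add: dcoef_def assms)
qed

text \<open>Regularity replaces the x_1 term of Euler's identity by - w_1 times the units acting on
  the other derivatives; joined with the w_k terms this is left multiplication by
  \<open>eta t k w\<close>.\<close>

lemma homog_Suc_regular:
  assumes "\<And>\<alpha>. regular_coef t c \<alpha> = 0"
  shows "real (Suc N) *\<^sub>R homog c (Suc N) w = (\<Sum>k\<in>{2,3,4}. hmult t (eta t k w) (homog (dcoef k c) N w))"
proof -
  have "homog (regular_coef t c) N w = homog (dcoef 1 c) N w + (\<Sum>k\<in>{2,3,4}. hmult t (eta_unit t k) (homog (dcoef k c) N w))"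
    unfolding homog_def hmult.sum_right
    by (subst sum.swap)
       (simp only: regular_coef_def scaleR_add_right sum.distrib scaleR_sum_right hmult.scaleR_right)
  moreover have "homog (regular_coef t c) N w = 0" by (simp add: homog_def assms)
  ultimately have 1: "homog (dcoef 1 c) N w = - (\<Sum>k\<in>{2,3,4}. hmult t (eta_unit t k) (homog (dcoef k c) N w))"
    by (simp only: eq_neg_iff_add_eq_0)
  have "real (Suc N) *\<^sub>R homog c (Suc N) w = w$1 *\<^sub>R homog (dcoef 1 c) N w + (\<Sum>k\<in>{2,3,4}. w$k *\<^sub>R homog (dcoef k c) N w)"
    unfolding homog_euler UNIV_4 using four_neq by (subst sum.insert) auto
  also have "\<dots> = (\<Sum>k\<in>{2,3,4}. hmult t (eta t k w) (homog (dcoef k c) N w))"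
    unfolding 1 eta_def
    by (simp only: hmult.diff_left hmult.scaleR_left hmult_unit_assoc sum_subtractf scaleR_minus_right scaleR_sum_right uminus_add_conv_diff)
  finally show ?thesis .
qed

text \<open>Since \<beta>! (D_k c)_\<beta> = (\<beta> + e_k)! c_(\<beta> + e_k), shifting the index
  makes the right factor independent of \<open>k\<close>, and the recursion of \<open>fueter\<close>
  appears on the left of it. Only coefficients free of x_1 remain: a regular series is determined by
  its restriction to the hyperplane x_1 = 0.\<close>

lemma homog_eq_fueter:
  assumes "\<And>\<alpha>. regular_coef t c \<alpha> = 0"
  shows "homog c N w = (\<Sum>\<alpha>\<in>degset {2,3,4} N. hmult t (fueter t N \<alpha> w) (mfact \<alpha> *\<^sub>R c \<alpha>))"
  using assms
proof (induction N arbitrary: c)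
  case 0
  have "degset J 0 = {\<lambda>_. 0}" for J :: "4 set" by (auto simp: degset_def fun_eq_iff)
  then show ?case by (simp add: homog_def mpow_def mfact_def hmult_unit_assoc)
next
  case (Suc N)
  let ?K = "{2,3,4} :: 4 set"
  let ?Y = "\<lambda>\<alpha>. mfact \<alpha> *\<^sub>R c \<alpha>"
  have "real (Suc N) *\<^sub>R homog c (Suc N) w
      = (\<Sum>k\<in>?K. \<Sum>\<beta>\<in>degset ?K N. hmult t (hmult t (eta t k w) (fueter t N \<beta> w)) (mfact \<beta> *\<^sub>R dcoef k c \<beta>))"
    unfolding homog_Suc_regular[OF Suc.prems] Suc.IH[OF regular_coef_dcoef[OF Suc.prems]]
    by (simp only: hmult.sum_right hmult_unit_assoc)
  also have "\<dots> = (\<Sum>k\<in>?K. \<Sum>\<alpha>\<in>degset ?K (Suc N). hmult t (hmult t (eta t k w) (low k (\<lambda>\<beta>. fueter t N \<beta> w) \<alpha>)) (?Y \<alpha>))"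
  proof (rule sum.cong[OF refl])
    fix k assume k: "k \<in> ?K"
    show "(\<Sum>\<beta>\<in>degset ?K N. hmult t (hmult t (eta t k w) (fueter t N \<beta> w)) (mfact \<beta> *\<^sub>R dcoef k c \<beta>))
      = (\<Sum>\<alpha>\<in>degset ?K (Suc N). hmult t (hmult t (eta t k w) (low k (\<lambda>\<beta>. fueter t N \<beta> w) \<alpha>)) (?Y \<alpha>))"
      by (subst sum_degset_shift[OF k])
         (auto simp: low_def hmult.zero_right hmult.zero_left mfact_Suc dcoef_def mult_ac simp del: of_nat_Suc)
  qed
  also have "\<dots> = (\<Sum>\<alpha>\<in>degset ?K (Suc N). \<Sum>k\<in>?K. hmult t (hmult t (eta t k w) (low k (\<lambda>\<beta>. fueter t N \<beta> w) \<alpha>)) (?Y \<alpha>))"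
    by (rule sum.swap)
  also have "\<dots> = (\<Sum>\<alpha>\<in>degset ?K (Suc N). hmult t (real (Suc N) *\<^sub>R fueter t (Suc N) \<alpha> w) (?Y \<alpha>))"
    by (simp only: hmult.sum_left[symmetric] sum_eta_low)
  also have "\<dots> = real (Suc N) *\<^sub>R (\<Sum>\<alpha>\<in>degset ?K (Suc N). hmult t (fueter t (Suc N) \<alpha> w) (?Y \<alpha>))"
    by (simp only: hmult.scaleR_left scaleR_sum_right)
  finally show ?case by (simp del: of_nat_Suc fueter.simps sum.insert)
qed

text \<open>Sums along the graph of \<open>d\<close>, collapsing each fibre. With \<open>d\<close>
  the total degree it lets unordered series over different index sets be compared block by
  block.\<close>

lemma has_sum_fibres:
  fixes f :: "'i \<Rightarrow> 'b::{topological_comm_monoid_add,t3_space}"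
  assumes "(f has_sum S) UNIV" "\<And>N::'j. finite {i. d i = N}"
  shows "((\<lambda>N. \<Sum>i | d i = N. f i) has_sum S) UNIV"
proof (rule has_sum_SigmaD)
  show "((\<lambda>p. f (snd p)) has_sum S) (Sigma UNIV (\<lambda>N. {i. d i = N}))"
    using assms(1)
    by (subst has_sum_reindex_bij_witness[where i="\<lambda>i. (d i, i)" and j=snd and T=UNIV and h=f and s'=S]) auto
  show "((\<lambda>i. f (snd (N, i))) has_sum (\<Sum>i | d i = N. f i)) {i. d i = N}" for N
    by (rule has_sum_finiteI) (use assms(2) in auto)
qed

lemma degset_multi_idx: "bij_betw multi_idx {n. deg n = N} (degset {2,3,4} N)"
proof (rule bij_betw_byWitness[where f'="\<lambda>\<alpha>. (\<alpha> 2, \<alpha> 3, \<alpha> 4)"])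
  show "\<forall>n\<in>{n. deg n = N}. (multi_idx n 2, multi_idx n 3, multi_idx n 4) = n"
    using four_neq by (auto simp: multi_idx_def)
  show "\<forall>\<alpha>\<in>degset {2,3,4} N. multi_idx (\<alpha> 2, \<alpha> 3, \<alpha> 4) = \<alpha>"
  proof (intro ballI ext)
    fix \<alpha> k assume "\<alpha> \<in> degset {2,3,4::4} N"
    then show "multi_idx (\<alpha> 2, \<alpha> 3, \<alpha> 4) k = \<alpha> k"
      using exhaust_4[of k] four_neq by (auto simp: multi_idx_def degset_def)
  qed
  show "multi_idx ` {n. deg n = N} \<subseteq> degset {2,3,4} N"
    using four_neq four_neq[symmetric] by (auto simp: multi_idx_def degset_def deg_def)
  show "(\<lambda>\<alpha>. (\<alpha> 2, \<alpha> 3, \<alpha> 4)) ` degset {2,3,4::4} N \<subseteq> {n. deg n = N}"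
    using four_neq by (auto simp: degset_def deg_def)
qed

section \<open>The Fueter series\<close>

lemma has_sum_finite_sum:
  fixes f :: "'k \<Rightarrow> 'i \<Rightarrow> 'b::topological_comm_monoid_add"
  assumes "finite K" "\<And>k. k \<in> K \<Longrightarrow> (f k has_sum s k) A"
  shows "((\<lambda>i. \<Sum>k\<in>K. f k i) has_sum (\<Sum>k\<in>K. s k)) A"
  using assms by (induction K rule: finite_induct) (auto intro: has_sum_add)

text \<open>A Cauchy estimate without integrals: at the diagonal point with all coordinates
  \<open>\<rho>\<close>, of norm at most r/2, the series converges absolutely, and its total bounds
  every single term.\<close>

lemma powser_coef_bound:
  fixes c :: "('n::finite \<Rightarrow> nat) \<Rightarrow> 'b::euclidean_space"
  assumes "powser c r 0 f" "0 < r"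
  obtains \<rho> A where "0 < \<rho>" "0 \<le> A" "\<And>\<alpha>. norm (c \<alpha>) * \<rho> ^ (\<Sum>k\<in>UNIV. \<alpha> k) \<le> A"
proof -
  define \<rho> where "\<rho> = r / (2 * real CARD('n))"
  have \<rho>: "0 < \<rho>" using assms(2) by (simp add: \<rho>_def)
  define z :: "real ^ 'n" where "z = (\<chi> k. \<rho>)"
  have "norm z \<le> (\<Sum>k\<in>UNIV. \<bar>z$k\<bar>)" by (rule norm_le_l1_cart)
  also have "\<dots> = r / 2" using \<rho> by (simp add: z_def) (simp add: \<rho>_def)
  finally have "z \<in> ball 0 r" using assms(2) by simp
  then have "((\<lambda>\<alpha>. mpow (z - 0) \<alpha> *\<^sub>R c \<alpha>) has_sum f z) UNIV"
    using assms(1) unfolding powser_def by blast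
  then have sm: "(\<lambda>\<alpha>. norm (mpow z \<alpha> *\<^sub>R c \<alpha>)) summable_on UNIV"
    using summable_on_imp_norm_summable_on[OF has_sum_imp_summable] by force
  have "norm (c \<alpha>) * \<rho> ^ (\<Sum>k\<in>UNIV. \<alpha> k) \<le> (\<Sum>\<^sub>\<infinity>\<alpha>. norm (mpow z \<alpha> *\<^sub>R c \<alpha>))" for \<alpha>
  proof -
    have "norm (c \<alpha>) * \<rho> ^ (\<Sum>k\<in>UNIV. \<alpha> k) = norm (mpow z \<alpha> *\<^sub>R c \<alpha>)"
      using \<rho> by (simp add: mpow_def z_def power_sum abs_prod)
    also have "\<dots> \<le> (\<Sum>\<^sub>\<infinity>\<alpha>. norm (mpow z \<alpha> *\<^sub>R c \<alpha>))"
      using finite_sum_le_has_sum[OF has_sum_infsum[OF sm], of "{\<alpha>}"] by simp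
    finally show ?thesis .
  qed
  moreover have "0 \<le> (\<Sum>\<^sub>\<infinity>\<alpha>. norm (mpow z \<alpha> *\<^sub>R c \<alpha>))" by (rule infsum_nonneg) simp
  ultimately show thesis using that \<rho> by blast
qed

lemma summable_on_power_deg: "(\<lambda>n. (1/2::real) ^ deg n) summable_on UNIV"
proof -
  have "insert 0 {1::nat..} = UNIV" by auto
  then have geo: "((\<lambda>n. (1/2::real) ^ n) has_sum 2) UNIV"
    using has_sum_insert[OF _ has_sum_geometric_from_1[of "1/2::real"], of 0] by simp
  have two: "((\<lambda>n. (1/2::real) ^ k * (1/2) ^ n) has_sum (1/2) ^ k * 2) UNIV" for k
    by (rule has_sum_cmult_right[OF geo])
  have "(\<lambda>(m, n). (1/2::real) ^ (m + n)) summable_on (UNIV \<times> UNIV)"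
    by (rule summable_on_SigmaI[where g="\<lambda>m. (1/2) ^ m * 2"])
       (auto simp: power_add intro!: two summable_on_cmult_left has_sum_imp_summable[OF geo])
  then obtain s where s: "((\<lambda>(m, n). (1/2::real) ^ (m + n)) has_sum s) UNIV"
    by (auto simp: summable_on_def)
  have "(\<lambda>n. (1/2::real) ^ deg n) summable_on (UNIV \<times> UNIV)"
  proof (rule summable_on_SigmaI[where g="\<lambda>k. (1/2) ^ k * s"])
    show "((\<lambda>y. (1/2::real) ^ deg (k, y)) has_sum (1/2) ^ k * s) UNIV" for k
      using has_sum_cmult_right[OF s, of "(1/2) ^ k"]
      by (simp add: deg_def case_prod_unfold power_add mult.assoc)
    show "(\<lambda>k. (1/2::real) ^ k * s) summable_on UNIV"
      by (intro summable_on_cmult_left has_sum_imp_summable[OF geo])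
  qed auto
  then show ?thesis by simp
qed

lemma sum_multi_idx: "(\<Sum>k\<in>UNIV. multi_idx n k) = deg n" "(\<Sum>k\<in>{2,3,4}. multi_idx n k) = deg n"
proof -
  obtain n1 n2 n3 where n: "n = (n1, n2, n3)" by (cases n)
  show "(\<Sum>k\<in>UNIV. multi_idx n k) = deg n" "(\<Sum>k\<in>{2,3,4}. multi_idx n k) = deg n"
    unfolding UNIV_4 n using four_neq four_neq[symmetric] by (simp_all add: multi_idx_def deg_def)
qed

lemma partial_multi_eq_iter_partial: "partial_multi n f = iter_partial (multi_idx n) f"
proof -
  obtain n1 n2 n3 where n: "n = (n1, n2, n3)" by (cases n)
  show ?thesis
    unfolding n using four_neq four_neq[symmetric] by (simp add: partial_multi_def iter_partial_def multi_idx_def)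
qed

lemma fueter_series:
  assumes "powser c r 0 f" "0 < r"
  obtains \<delta> g where "0 < \<delta>" "\<delta> \<le> r"
    "\<And>w. w \<in> ball 0 \<delta> \<Longrightarrow> ((\<lambda>n. hmult t (fueter t (deg n) (multi_idx n) w) (mfact (multi_idx n) *\<^sub>R c (multi_idx n))) has_sum g w) UNIV"
    "\<And>w. w \<in> ball 0 \<delta> \<Longrightarrow> \<exists>G. (g has_derivative G) (at w) \<and>
        G (axis 1 1) + (\<Sum>k\<in>{2,3,4}. hmult t (eta_unit t k) (G (axis k 1))) = 0"
proof -
  obtain Q where Q: "0 < Q" "\<And>k w x. norm (hmult t (eta t k w) x) \<le> Q * norm w * norm x"
    using norm_hmult_eta_le by blast
  obtain C where C: "0 < C" "\<And>x y. norm (hmult t x y) \<le> norm x * norm y * C"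
    using hmult.pos_bounded by blast
  obtain \<rho> A where A: "0 < \<rho>" "0 \<le> A" "\<And>\<alpha>. norm (c \<alpha>) * \<rho> ^ (\<Sum>k\<in>UNIV. \<alpha> k) \<le> A"
    using powser_coef_bound[OF assms] by blast
  \<comment> \<open>On this ball \<open>Q * norm w\<close> is at most \<open>\<rho> / 4\<close>, so
    the terms decay like 4^(-|n|). The derivatives carry an extra factor |n|, at most 2^|n|, which
    still leaves 2^(-|n|).\<close>
  define \<delta> where "\<delta> = min r (\<rho> / (4 * Q))"
  have \<delta>: "0 < \<delta>" "\<delta> \<le> r" using assms(2) A(1) Q(1) by (auto simp: \<delta>_def)
  have Qw: "Q * norm w \<le> \<rho> / 4" if "w \<in> ball 0 \<delta>" for w
  proof -
    have "norm w \<le> \<rho> / (4 * Q)" using that by (simp add: \<delta>_def)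
    then have "Q * norm w \<le> Q * (\<rho> / (4 * Q))" using Q(1) by (intro mult_left_mono) auto
    then show ?thesis using Q(1) by simp
  qed
  define Y where "Y n = mfact (multi_idx n) *\<^sub>R c (multi_idx n)" for n
  have Y: "norm (Y n) \<le> mfact (multi_idx n) * (A / \<rho> ^ deg n)" for n
  proof -
    have "norm (c (multi_idx n)) \<le> A / \<rho> ^ deg n"
      using A(3)[of "multi_idx n"] A(1) by (simp add: sum_multi_idx pos_le_divide_eq)
    then have "mfact (multi_idx n) * norm (c (multi_idx n)) \<le> mfact (multi_idx n) * (A / \<rho> ^ deg n)"
      using mfact_pos[of "multi_idx n"] by (intro mult_left_mono) auto
    then show ?thesis using mfact_pos[of "multi_idx n"] by (simp add: Y_def)
  qed
  \<comment> \<open>From N \<le> 2^N; the constant 4 pays for the exponent N - 1 in place of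
    N.\<close>
  have half: "real N * (1/4) ^ (N - 1) \<le> 4 * (1/2::real) ^ N" for N
  proof (cases N)
    case (Suc M)
    have "real N \<le> 2 ^ N" using of_nat_mono[OF less_imp_le[OF less_exp[of N]], where 'a=real] by simp
    then have "real N * (1/4) ^ (N - 1) \<le> 2 ^ N * (1/4) ^ (N - 1)" by (intro mult_right_mono) auto
    also have "\<dots> = 4 * (1/2::real) ^ N"
    proof -
      have "(2::real) ^ M * (1/4) ^ M = (1/2) ^ M" by (simp flip: power_mult_distrib)
      then show ?thesis by (simp add: Suc)
    qed
    finally show ?thesis .
  qed simp
  define F where "F n w = hmult t (fueter t (deg n) (multi_idx n) w) (Y n)" for n w
  define F' where "F' n w h = hmult t (dfueter t (deg n) (multi_idx n) w h) (Y n)" for n w h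
  have F_le: "norm (F n w) \<le> (C * A) * (1/2) ^ deg n" if w: "w \<in> ball 0 \<delta>" for n w
  proof -
    have "norm (fueter t (deg n) (multi_idx n) w) \<le> (Q * norm w) ^ deg n / mfact (multi_idx n)"
      by (rule norm_fueter_le[OF Q]) (simp add: sum_multi_idx(2) del: sum.insert)
    also have "\<dots> \<le> (\<rho> / 4) ^ deg n / mfact (multi_idx n)"
      using Qw[OF w] Q(1) mfact_pos[of "multi_idx n"] by (intro divide_right_mono power_mono) auto
    finally have "norm (fueter t (deg n) (multi_idx n) w) * norm (Y n) * C
        \<le> ((\<rho> / 4) ^ deg n / mfact (multi_idx n)) * (mfact (multi_idx n) * (A / \<rho> ^ deg n)) * C"
      using C(1) A mfact_pos[of "multi_idx n"] by (intro mult_right_mono mult_mono Y) auto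
    also have "\<dots> = (C * A) * (1/4) ^ deg n"
      using A(1) by (simp add: power_divide)
    also have "\<dots> \<le> (C * A) * (1/2) ^ deg n"
      using A C by (intro mult_left_mono power_mono) auto
    finally show ?thesis using C(2) order_trans unfolding F_def by blast
  qed
  have F'_le: "norm (F' n w h) \<le> (4 * Q * A * C / \<rho>) * (1/2) ^ deg n * norm h" if w: "w \<in> ball 0 \<delta>" for n w h
  proof (cases "deg n")
    case 0
    then show ?thesis using Q(1) A C(1) by (simp add: F'_def hmult.zero_left)
  next
    case (Suc N)
    have "norm (dfueter t (deg n) (multi_idx n) w h) \<le> real (deg n) * (Q * norm h * (Q * norm w) ^ (deg n - 1) / mfact (multi_idx n))"
      by (rule norm_dfueter_le[OF Q]) (simp add: sum_multi_idx(2) del: sum.insert)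
    also have "\<dots> \<le> real (deg n) * (Q * norm h * (\<rho> / 4) ^ (deg n - 1) / mfact (multi_idx n))"
      using Qw[OF w] Q(1) mfact_pos[of "multi_idx n"] by (intro mult_left_mono divide_right_mono power_mono) auto
    finally have "norm (dfueter t (deg n) (multi_idx n) w h) * norm (Y n) * C
        \<le> (real (deg n) * (Q * norm h * (\<rho> / 4) ^ (deg n - 1) / mfact (multi_idx n))) * (mfact (multi_idx n) * (A / \<rho> ^ deg n)) * C"
      using C(1) A Q(1) mfact_pos[of "multi_idx n"] by (intro mult_right_mono mult_mono Y) auto
    also have "\<dots> = (Q * A * C / \<rho> * norm h) * (real (deg n) * (1/4) ^ (deg n - 1))"
      using A(1) by (simp add: Suc power_divide field_simps)
    also have "\<dots> \<le> (Q * A * C / \<rho> * norm h) * (4 * (1/2) ^ deg n)"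
      using A C(1) Q(1) by (intro mult_left_mono half) auto
    also have "\<dots> = (4 * Q * A * C / \<rho>) * (1/2) ^ deg n * norm h" by simp
    finally show ?thesis using C(2) order_trans unfolding F'_def by blast
  qed
  define g where "g w = (\<Sum>\<^sub>\<infinity>n. F n w)" for w
  have g: "((\<lambda>n. F n w) has_sum g w) UNIV" if "w \<in> ball 0 \<delta>" for w
  proof -
    have "(\<lambda>n. norm (F n w)) summable_on UNIV"
      by (rule Infinite_Sum.abs_summable_on_comparison_test'[where g="\<lambda>n. (C * A) * (1/2) ^ deg n"])
         (rule summable_on_cmult_right[OF summable_on_power_deg], rule F_le[OF that])
    then show ?thesis unfolding g_def by (rule has_sum_infsum[OF abs_summable_summable])
  qed
  show thesis
  proof (rule that[OF \<delta>])
    fix w :: "real ^ 4" assume w: "w \<in> ball 0 \<delta>"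
    show "((\<lambda>n. hmult t (fueter t (deg n) (multi_idx n) w) (mfact (multi_idx n) *\<^sub>R c (multi_idx n))) has_sum g w) UNIV"
      using g[OF w] by (simp add: F_def Y_def)
    have F: "(F n has_derivative F' n v) (at v)" for n v
      unfolding F_def F'_def
      by (rule bounded_linear.has_derivative[OF hmult.bounded_linear_left has_derivative_fueter])
    have M: "0 \<le> (4 * Q * A * C / \<rho>) * (1/2) ^ deg n" for n using A C(1) Q(1) by simp
    have Ms: "(\<lambda>n. (4 * Q * A * C / \<rho>) * (1/2) ^ deg n) summable_on UNIV"
      by (rule summable_on_cmult_right[OF summable_on_power_deg])
    note der = has_derivative_infsum[OF convex_ball open_ball w F M Ms F'_le g]
    let ?G = "\<lambda>h. \<Sum>\<^sub>\<infinity>n. F' n w h"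
    have hs: "((\<lambda>n. F' n w h) has_sum ?G h) UNIV" for h by (rule der(2))
    \<comment> \<open>The operator acts termwise because left multiplication by a unit is
      continuous. By associativity the right factor \<open>Y n\<close> comes out, and
      \<open>dfueter_regular\<close> annihilates every term.\<close>
    have "((\<lambda>n. F' n w (axis 1 1) + (\<Sum>k\<in>{2,3,4}. hmult t (eta_unit t k) (F' n w (axis k 1)))) has_sum
       (?G (axis 1 1) + (\<Sum>k\<in>{2,3,4}. hmult t (eta_unit t k) (?G (axis k 1))))) UNIV"
      by (intro has_sum_add hs has_sum_finite_sum has_sum_bounded_linear[OF hmult.bounded_linear_right]) simp
    moreover have "F' n w (axis 1 1) + (\<Sum>k\<in>{2,3,4}. hmult t (eta_unit t k) (F' n w (axis k 1))) = 0" for n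
      unfolding F'_def hmult_unit_assoc(3)[symmetric] hmult.sum_left[symmetric] hmult.add_left[symmetric] dfueter_regular
      by (rule hmult.zero_left)
    ultimately have "((\<lambda>n. 0) has_sum (?G (axis 1 1) + (\<Sum>k\<in>{2,3,4}. hmult t (eta_unit t k) (?G (axis k 1))))) (UNIV :: (nat \<times> nat \<times> nat) set)"
      by (simp only:)
    then have "?G (axis 1 1) + (\<Sum>k\<in>{2,3,4}. hmult t (eta_unit t k) (?G (axis k 1))) = 0"
      using has_sum_0_simp by (rule has_sum_unique)
    with der(1) show "\<exists>G. (g has_derivative G) (at w) \<and>
        G (axis 1 1) + (\<Sum>k\<in>{2,3,4}. hmult t (eta_unit t k) (G (axis k 1))) = 0" by blast
  qed
qed

lemma powser_nabla:
  assumes "powser c r a f"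
  shows "powser (regular_coef t c) r a (nabla t f)"
proof -
  have part: "powser (\<lambda>\<alpha>. hmult t (eta_unit t k) (dcoef k c \<alpha>)) r a (\<lambda>w. hmult t (eta_unit t k) (partial k f w))" for k
    by (rule powser_bounded_linear[OF powser_partial[OF assms] hmult.bounded_linear_right])
  have "powser (\<lambda>\<alpha>. dcoef 1 c \<alpha> + (hmult t (eta_unit t 2) (dcoef 2 c \<alpha>) + (hmult t (eta_unit t 3) (dcoef 3 c \<alpha>) + hmult t (eta_unit t 4) (dcoef 4 c \<alpha>)))) r a
     (\<lambda>w. partial 1 f w + (hmult t (eta_unit t 2) (partial 2 f w) + (hmult t (eta_unit t 3) (partial 3 f w) + hmult t (eta_unit t 4) (partial 4 f w))))"
    by (intro powser_add powser_partial assms part)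
  moreover have "regular_coef t c \<alpha> = dcoef 1 c \<alpha> + (hmult t (eta_unit t 2) (dcoef 2 c \<alpha>) + (hmult t (eta_unit t 3) (dcoef 3 c \<alpha>) + hmult t (eta_unit t 4) (dcoef 4 c \<alpha>)))" for \<alpha>
    by (simp add: regular_coef_def)
  moreover have "nabla t f w = partial 1 f w + (hmult t (eta_unit t 2) (partial 2 f w) + (hmult t (eta_unit t 3) (partial 3 f w) + hmult t (eta_unit t 4) (partial 4 f w)))" for w
    by (simp add: nabla_eq)
  ultimately show ?thesis by presburger
qed

text \<open>Both series are regrouped by total degree, where \<open>homog_eq_fueter\<close>
  identifies the blocks. Splitting a block into its single terms is not a legitimate step for
  infinite sums, so convergence of the finer series is a hypothesis.\<close>

lemma fueter_series_eq:
  assumes c: "powser c r 0 f" and reg: "\<And>\<alpha>. regular_coef t c \<alpha> = 0" and w: "w \<in> ball 0 r"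
    and g: "((\<lambda>n. hmult t (fueter t (deg n) (multi_idx n) w) (mfact (multi_idx n) *\<^sub>R c (multi_idx n))) has_sum g) UNIV"
  shows "f w = g"
proof -
  have fin: "finite {n. deg n = N}" for N
    using degset_multi_idx[of N] by (simp add: bij_betw_finite)
  have "{\<alpha> :: 4 \<Rightarrow> nat. (\<Sum>k\<in>UNIV. \<alpha> k) = N} = degset UNIV N" for N by (simp add: degset_def)
  moreover have "((\<lambda>\<alpha>. mpow w \<alpha> *\<^sub>R c \<alpha>) has_sum f w) UNIV"
    using c w unfolding powser_def by fastforce
  ultimately have "((\<lambda>N. homog c N w) has_sum f w) UNIV"
    using has_sum_fibres[of "\<lambda>\<alpha>. mpow w \<alpha> *\<^sub>R c \<alpha>" "f w" "\<lambda>\<alpha>. \<Sum>k\<in>UNIV. \<alpha> k"] by (simp add: homog_def)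
  moreover have "homog c N w = (\<Sum>n | deg n = N. hmult t (fueter t (deg n) (multi_idx n) w) (mfact (multi_idx n) *\<^sub>R c (multi_idx n)))" for N
    unfolding homog_eq_fueter[of t c, OF reg] sum.reindex_bij_betw[OF degset_multi_idx, symmetric]
    by (rule sum.cong) auto
  ultimately show ?thesis
    using has_sum_fibres[OF g fin] has_sum_unique by fastforce
qed

text \<open>In general a series at 0 represents an analytic function only near 0, hence the
  neighbourhood \<open>V\<close>. The index (0,0,0) is left out because its term is the separately
  displayed \<open>f 0\<close>.\<close>

theorem theorem47:
  fixes t :: real and U :: "(real ^ 4) set" and f :: "real ^ 4 \<Rightarrow> real ^ 4"
  assumes "t \<noteq> 0"
    and "openin (htop t) U" and "connectedin (htop t) U" and "0 \<in> U"
    and "f differentiable_on U"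
    and "real_analytic_on f U"
  shows "left_regular_on t f U \<longleftrightarrow>
    (\<exists>V. openin (htop t) V \<and> 0 \<in> V \<and> V \<subseteq> U \<and>
      (\<forall>w\<in>V.
        (\<lambda>n. hmult t (eta_pow t n w) (partial_multi n f 0)) summable_on (UNIV - {(0, 0, 0)}) \<and>
        f w = f 0 + (\<Sum>\<^sub>\<infinity>n\<in>UNIV - {(0, 0, 0)}. hmult t (eta_pow t n w) (partial_multi n f 0))))"
    (is "_ \<longleftrightarrow> ?expansion")
proof -
  have U: "open U" "connected U"
    using assms(2,3) by (simp_all add: htop_eq_euclidean[OF assms(1)])
  obtain c r where c: "0 < r" "powser c r 0 f"
    using assms(4,6) unfolding real_analytic_on_powser by blast
  let ?term = "\<lambda>n w. hmult t (eta_pow t n w) (partial_multi n f 0)"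
  have term_eq: "?term n w = hmult t (fueter t (deg n) (multi_idx n) w) (mfact (multi_idx n) *\<^sub>R c (multi_idx n))" for n w
    by (simp only: eta_pow_eq_fueter partial_multi_eq_iter_partial iter_partial_center[OF c(2,1)])
  obtain \<delta> g where \<delta>: "0 < \<delta>" "\<delta> \<le> r"
    and g: "\<And>w. w \<in> ball 0 \<delta> \<Longrightarrow> ((\<lambda>n. ?term n w) has_sum g w) UNIV"
    and dg: "\<And>w. w \<in> ball 0 \<delta> \<Longrightarrow> \<exists>G. (g has_derivative G) (at w) \<and>
        G (axis 1 1) + (\<Sum>k\<in>{2,3,4}. hmult t (eta_unit t k) (G (axis k 1))) = 0"
    using fueter_series[OF c(2,1), of t] unfolding term_eq by blast
  have term0: "?term (0, 0, 0) w = f 0" for w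
  proof -
    have "multi_idx (0, 0, 0) = (\<lambda>_. 0)" by (auto simp: multi_idx_def)
    then show ?thesis
      unfolding term_eq powser_center[OF c(2,1)] by (simp add: deg_def hmult_unit_assoc mfact_def)
  qed
  have g0: "((\<lambda>n. ?term n w) has_sum (g w - f 0)) (UNIV - {(0, 0, 0)})" if "w \<in> ball 0 \<delta>" for w
    by (rule has_sum_Diff[OF g[OF that]]) (rule has_sum_finiteI, auto simp: term0)
  show ?thesis
  proof
    assume reg: "left_regular_on t f U"
    obtain e where e: "0 < e" "ball 0 e \<subseteq> U"
      using U(1) assms(4) open_contains_ball by blast
    \<comment> \<open>Regularity is known on \<open>U\<close> and the expansion on the ball of
      radius \<open>r\<close>; the two series of \<open>nabla t f\<close> are compared on a ball
      where both are available.\<close>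
    have "powser (regular_coef t c) (min e r) 0 (nabla t f)"
      by (rule powser_mono[OF powser_nabla[OF c(2)]]) simp
    moreover have "powser (\<lambda>_. 0) (min e r) 0 (nabla t f)"
      using powser_zero by (rule powser_cong) (use reg e in \<open>auto simp: left_regular_on_def\<close>)
    ultimately have "regular_coef t c = (\<lambda>_. 0)"
      by (rule powser_unique) (use e(1) c(1) in auto)
    then have fg: "f w = g w" if "w \<in> ball 0 \<delta>" for w
      using fueter_series_eq[OF c(2), of t w "g w"] g[OF that] that \<delta>(2) unfolding term_eq by simp
    show ?expansion
    proof (intro exI[of _ "ball 0 \<delta> \<inter> U"] conjI ballI)
      show "openin (htop t) (ball 0 \<delta> \<inter> U)"
        using U by (simp add: htop_eq_euclidean[OF assms(1)] open_Int)
      fix w assume "w \<in> ball 0 \<delta> \<inter> U"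
      then have w: "w \<in> ball 0 \<delta>" by simp
      show "(\<lambda>n. ?term n w) summable_on (UNIV - {(0, 0, 0)})"
        using g0[OF w] by (rule has_sum_imp_summable)
      show "f w = f 0 + (\<Sum>\<^sub>\<infinity>n\<in>UNIV - {(0, 0, 0)}. ?term n w)"
        using infsumI[OF g0[OF w]] fg[OF w] by simp
    qed (use \<delta> assms(4) in auto)
  next
    assume ?expansion
    then obtain V where V: "open V" "0 \<in> V" "V \<subseteq> U"
      and exp: "\<And>w. w \<in> V \<Longrightarrow> f w = f 0 + (\<Sum>\<^sub>\<infinity>n\<in>UNIV - {(0, 0, 0)}. ?term n w)"
      by (auto simp: htop_eq_euclidean[OF assms(1)])
    let ?W = "V \<inter> ball 0 \<delta>"
    have W: "open ?W" "0 \<in> ?W" "?W \<subseteq> U" using V \<delta> by auto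
    have fg: "f w = g w" if "w \<in> ?W" for w
      using exp[of w] infsumI[OF g0[of w]] that by simp
    have zero: "nabla t f w = 0" if w: "w \<in> ?W" for w
    proof -
      obtain G where G: "(g has_derivative G) (at w)"
        "G (axis 1 1) + (\<Sum>k\<in>{2,3,4}. hmult t (eta_unit t k) (G (axis k 1))) = 0"
        using dg[of w] w by blast
      have "(f has_derivative G) (at w)"
        by (rule has_derivative_transform_within_open[OF G(1) W(1) w]) (simp add: fg)
      then show ?thesis using G(2) by (simp only: nabla_eq partial_eq)
    qed
    have "real_analytic_on (nabla t f) U"
      using assms(6) powser_nabla unfolding real_analytic_on_powser by blast
    then have "nabla t f w = 0" if "w \<in> U" for w
      using zero that by (rule real_analytic_identity[OF U _ W])
    then show "left_regular_on t f U"
      using assms(5) by (simp add: left_regular_on_def)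
  qed
qed

end
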